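(* Let $X_1,\dots,X_n$ be i.i.d. real random variables with probability density $f$, and let $f_n(x;h)$ be the sinc estimator of $f$. Let $m\ge0$ be an integer, and suppose that $f$ is $m$ times differentiable and its $m$-th derivative $f^{(m)}$ is square integrable. Then there is a function $\varepsilon(h)$ of $h>0$ (not depending on $n$) with $\varepsilon(h)\le1$ for all $h$ and $\varepsilon(h)\to0$ as $h\to0$ such that, for all $n\ge1$ and $h>0$, $$\mathrm{MISE}(f_n(x;h))<\varepsilon(h)\,h^{2m}R(f^{(m)})+\frac{1}{\pi nh}.$$
   Context: The sinc estimator with bandwidth $h>0$ is $f_n(x;h)=\frac{1}{\pi n}\sum_{j=1}^n\frac{\sin[(x-X_j)/h]}{x-X_j}$. $\mathrm{MISE}(f_n(x;h))=\mathrm{E}\int_{-\infty}^{\infty}[f_n(x;h)-f(x)]^2\,dx$. For a real function $g$, $R(g)=\int_{-\infty}^{\infty} g^2(x)\,dx$. The $0$-th derivative is $f^{(0)}=f$. *)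

theory Defs
  imports "HOL-Probability.Probability"
begin

definition prob_density :: "(real \<Rightarrow> real) \<Rightarrow> bool" where
  "prob_density f \<longleftrightarrow>
     f \<in> borel_measurable borel \<and> (\<forall>x. 0 \<le> f x) \<and> (\<integral>\<^sup>+x. ennreal (f x) \<partial>lborel) = 1"

definition iid_sample :: "'a measure \<Rightarrow> (real \<Rightarrow> real) \<Rightarrow> nat \<Rightarrow> (nat \<Rightarrow> 'a \<Rightarrow> real) \<Rightarrow> bool" where
  "iid_sample M f n X \<longleftrightarrow>
     prob_space M \<and>
     prob_space.indep_vars M (\<lambda>_. borel) X {1..n} \<and>
     (\<forall>j\<in>{1..n}. distributed M lborel (X j) (\<lambda>x. ennreal (f x)))"

text \<open>At a data point the quotient \<open>sin ((x - X j) / h) / (x - X j)\<close> is read as its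
  limit \<open>1 / h\<close> (and not as \<open>0\<close>, the value of \<open>0 / 0\<close>).\<close>

definition sinc_estimator :: "nat \<Rightarrow> real \<Rightarrow> (nat \<Rightarrow> real) \<Rightarrow> real \<Rightarrow> real" where
  "sinc_estimator n h X x =
     1 / (pi * real n) *
     (\<Sum>j=1..n. if x = X j then 1 / h else sin ((x - X j) / h) / (x - X j))"

text \<open>Extended-valued, so that a divergent integral gives \<open>\<infinity>\<close> rather than \<open>0\<close>.\<close>

definition MISE ::
  "'a measure \<Rightarrow> (nat \<Rightarrow> 'a \<Rightarrow> real) \<Rightarrow> (real \<Rightarrow> real) \<Rightarrow> nat \<Rightarrow> real \<Rightarrow> ennreal" where
  "MISE M X f n h =
     (\<integral>\<^sup>+\<omega>. (\<integral>\<^sup>+x. ennreal ((sinc_estimator n h (\<lambda>j. X j \<omega>) x - f x)\<^sup>2) \<partial>lborel) \<partial>M)"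

definition times_differentiable :: "nat \<Rightarrow> (real \<Rightarrow> real) \<Rightarrow> bool" where
  "times_differentiable m f \<longleftrightarrow> (\<forall>k<m. \<forall>x. (deriv ^^ k) f differentiable (at x))"

definition square_integrable :: "(real \<Rightarrow> real) \<Rightarrow> bool" where
  "square_integrable g \<longleftrightarrow> g \<in> borel_measurable borel \<and> integrable lborel (\<lambda>x. (g x)\<^sup>2)"

definition R :: "(real \<Rightarrow> real) \<Rightarrow> real" where
  "R g = (\<integral>x. (g x)\<^sup>2 \<partial>lborel)"

end

theory Submission
  imports Defs
begin

text \<open>
  Write $\hat f$ for the characteristic function of the density \<open>f\<close> and $K_h(y) = \sin(y/h)/(\pi y)$ for the sinc
  kernel, so that the estimator is the sample mean of $K_h(x - X_j)$. At each \<open>x\<close> its mean squared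
  error is variance plus squared bias, and integrating over \<open>x\<close> gives
  \[ \mathrm{MISE} = \frac1n \int \bigl(K_h^2 * f - (K_h * f)^2\bigr) + \int (K_h * f - f)^2. \]

  The kernel $K_h$ is the inverse Fourier transform of the indicator of $|t| \le 1/h$. Hence
  $\int K_h^2 * f = \int K_h^2 \le 1/(\pi h)$, and the first term is strictly below $1/(\pi n h)$ because $K_h * f$ does
  not vanish almost everywhere: its transform is $\hat f$ on the band $|t| \le 1/h$, which is close to \<open>1\<close> near
  \<open>0\<close> (\<open>nn_integral_sinc_variance_less\<close>).

  Convolution with $K_h$ removes exactly the frequencies beyond $1/h$, so the bias term is at most
  $\frac{1}{2\pi}\int_{|t|>1/h} |\hat f|^2$ (\<open>sinc_bias_le\<close>). There $1 \le (h t)^{2m}$, and the energy of $f^{(m)}$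
  controls the weighted integral, $\int t^{2m}|\hat f|^2 \le 2\pi R(f^{(m)})$ (\<open>nn_integral_weighted_fourier_le\<close>).
  So one may take
  \[ \varepsilon(h) = \frac{1}{2\pi R(f^{(m)})} \int_{|t| > 1/h} t^{2m} |\hat f(t)|^2\,dt, \]
  a normalised tail of a convergent integral, which is at most \<open>1\<close> and tends to \<open>0\<close> with \<open>h\<close>.

  Since \<open>f\<close> is integrable but $f^{(m)}$ only square integrable, the Fourier transform is used for integrable
  functions only, and the square integrable theory enters through one inequality,
  $\|\hat u\|_2^2 \le 2\pi\|u\|_2^2$ (\<open>plancherel_le\<close>), proved with a Gaussian cutoff. The derivative is reached by applying it
  to iterated difference quotients of \<open>f\<close>, the bias by pairing $f - K_h * f$ with continuous test
  functions and using duality (\<open>nn_integral_square_le_if_test\<close>).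
\<close>

section \<open>The Fourier transform of integrable functions\<close>

text \<open>With the sign of the exponent chosen as for characteristic functions, the transform of a density
  is its characteristic function, and the inverse transform is the reflected \<open>fourier\<close> divided
  by $2\pi$.\<close>

definition fourier :: "(real \<Rightarrow> complex) \<Rightarrow> real \<Rightarrow> complex" where
  "fourier u x = (CLINT t|lborel. iexp (t * x) * u t)"

lemma integrable_iexp_mult:
  fixes u :: "real \<Rightarrow> complex"
  assumes "integrable lborel u"
  shows "integrable lborel (\<lambda>t. iexp (c * t) * u t)" "integrable lborel (\<lambda>t. iexp (t * c) * u t)"
proof -
  have [measurable]: "u \<in> borel_measurable borel" using assms by auto
  show "integrable lborel (\<lambda>t. iexp (c * t) * u t)"
    by (rule Bochner_Integration.integrable_bound[OF assms]) (auto simp: norm_mult)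
  then show "integrable lborel (\<lambda>t. iexp (t * c) * u t)"
    by (simp add: mult.commute)
qed

lemma continuous_fourier:
  assumes "integrable lborel u"
  shows "isCont (fourier u) x"
proof -
  have [measurable]: "u \<in> borel_measurable borel" using assms by auto
  show ?thesis
    unfolding continuous_at_sequentially comp_def fourier_def
  proof safe
    fix X assume X: "X \<longlonglongrightarrow> x"
    show "(\<lambda>n. CLINT t|lborel. iexp (t * X n) * u t) \<longlonglongrightarrow> (CLINT t|lborel. iexp (t * x) * u t)"
    proof (rule integral_dominated_convergence[where w="\<lambda>t. norm (u t)"])
      show "AE t in lborel. (\<lambda>n. iexp (t * X n) * u t) \<longlonglongrightarrow> iexp (t * x) * u t"
        using X by (intro AE_I2 tendsto_intros)
    qed (use assms in \<open>auto simp: norm_mult\<close>)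
  qed
qed

lemma borel_measurable_fourier:
  assumes "integrable lborel u"
  shows "fourier u \<in> borel_measurable borel"
  using continuous_fourier[OF assms]
  by (intro borel_measurable_continuous_onI) (simp add: continuous_at_imp_continuous_on)

lemma borel_measurable_cnj [measurable]: "cnj \<in> borel_measurable borel"
  by (intro borel_measurable_continuous_onI continuous_intros)

lemma norm_fourier_le:
  assumes "integrable lborel u"
  shows "cmod (fourier u x) \<le> (\<integral>t. cmod (u t) \<partial>lborel)"
proof -
  have "cmod (fourier u x) \<le> (\<integral>t. cmod (iexp (t * x) * u t) \<partial>lborel)"
    unfolding fourier_def by (rule integral_norm_bound)
  then show ?thesis by (simp add: norm_mult)
qed

lemma integrable_fourier_mult:
  assumes "integrable lborel u" "integrable lborel \<psi>"
  shows "integrable lborel (\<lambda>x. fourier u x * \<psi> x)"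
proof -
  note [measurable] = assms borel_measurable_fourier[OF assms(1)]
  define B where "B = (\<integral>t. cmod (u t) \<partial>lborel)"
  show ?thesis
  proof (rule Bochner_Integration.integrable_bound)
    show "integrable lborel (\<lambda>x. B * norm (\<psi> x))" using assms by auto
    show "AE x in lborel. norm (fourier u x * \<psi> x) \<le> norm (B * norm (\<psi> x))"
      using norm_fourier_le[OF assms(1)] unfolding B_def
      by (intro AE_I2) (auto simp: norm_mult intro!: mult_right_mono)
  qed measurable
qed

lemma cnj_fourier: "cnj (fourier u x) = fourier (\<lambda>t. cnj (u t)) (- x)"
proof -
  have "cnj (fourier u x) = (CLINT t|lborel. cnj (iexp (t * x) * u t))"
    unfolding fourier_def by (rule Bochner_Integration.integral_cnj[symmetric])
  also have "\<dots> = fourier (\<lambda>t. cnj (u t)) (- x)"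
    unfolding fourier_def by (simp add: exp_cnj)
  finally show ?thesis .
qed

text \<open>The kernel \<open>iexp (t * x)\<close> is symmetric and of modulus one, so this is Fubini on an absolutely
  integrable function. All later exchanges of integrals on the Fourier side are instances of it.\<close>

lemma fourier_multiplication_formula:
  assumes u: "integrable lborel u" and \<psi>: "integrable lborel \<psi>"
  shows "(CLINT x|lborel. fourier u x * \<psi> x) = (CLINT t|lborel. u t * fourier \<psi> t)"
proof -
  note [measurable] = assms
  have int: "integrable (lborel \<Otimes>\<^sub>M lborel) (\<lambda>(x, t). \<psi> x * (iexp (t * x) * u t))"
  proof (rule lborel_pair.Fubini_integrable)
    show "integrable lborel (\<lambda>x. LINT t|lborel. norm (case (x, t) of (x, t) \<Rightarrow> \<psi> x * (iexp (t * x) * u t)))"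
      using \<psi> by (auto simp: norm_mult)
    show "AE x in lborel. integrable lborel (\<lambda>t. case (x, t) of (x, t) \<Rightarrow> \<psi> x * (iexp (t * x) * u t))"
      using integrable_iexp_mult[OF u] by (intro AE_I2) (auto simp del: mult.assoc)
  qed measurable
  have "(CLINT x|lborel. fourier u x * \<psi> x) = (CLINT x|lborel. CLINT t|lborel. \<psi> x * (iexp (t * x) * u t))"
    unfolding fourier_def by (simp add: mult.commute)
  also have "\<dots> = (CLINT t|lborel. CLINT x|lborel. \<psi> x * (iexp (t * x) * u t))"
    using lborel_pair.Fubini_integral[OF int] by simp
  also have "\<dots> = (CLINT t|lborel. CLINT x|lborel. u t * (iexp (x * t) * \<psi> x))"
    by (intro Bochner_Integration.integral_cong refl) (simp add: mult_ac)
  also have "\<dots> = (CLINT t|lborel. u t * fourier \<psi> t)"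
    unfolding fourier_def by simp
  finally show ?thesis .
qed

text \<open>All factors $2\pi$ in the Gaussian Parseval formula and its consequences come from this transform by scaling.\<close>

lemma fourier_std_normal:
  "(CLINT z|lborel. iexp (t * z) * of_real (std_normal_density z)) = of_real (exp (- t\<^sup>2 / 2))"
proof -
  have "of_real (exp (- t\<^sup>2 / 2)) = char std_normal_distribution t"
    by (simp add: char_std_normal_distribution)
  also have "\<dots> = (CLINT z|lborel. iexp (t * z) * of_real (std_normal_density z))"
    unfolding char_def
    by (subst integral_density) (auto simp: normal_density_nonneg scaleR_conv_of_real mult.commute)
  finally show ?thesis by simp
qed

lemma gaussian_eq_std_normal: "exp (- (\<epsilon> * x)\<^sup>2 / 2) = sqrt (2 * pi) * std_normal_density (\<epsilon> * x)"
  by (simp add: normal_density_def)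

lemma integrable_gaussian:
  assumes "\<epsilon> > 0" shows "integrable lborel (\<lambda>x. exp (- (\<epsilon> * x)\<^sup>2 / 2) :: real)"
proof -
  have "integrable lborel (\<lambda>x. sqrt (2 * pi) * std_normal_density (0 + \<epsilon> * x))"
    using assms by (intro integrable_mult_right lborel_integrable_real_affine) auto
  then show ?thesis unfolding gaussian_eq_std_normal by simp
qed

lemma fourier_gaussian:
  assumes "\<epsilon> > 0"
  shows "fourier (\<lambda>x. of_real (exp (- (\<epsilon> * x)\<^sup>2 / 2))) t =
    of_real (sqrt (2 * pi) / \<epsilon> * exp (- (t / \<epsilon>)\<^sup>2 / 2))"
proof -
  have "fourier (\<lambda>x. of_real (exp (- (\<epsilon> * x)\<^sup>2 / 2))) t
    = \<bar>1 / \<epsilon>\<bar> *\<^sub>R (CLINT z|lborel. iexp ((0 + 1 / \<epsilon> * z) * t)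
        * of_real (exp (- (\<epsilon> * (0 + 1 / \<epsilon> * z))\<^sup>2 / 2)))"
    unfolding fourier_def using assms by (intro lborel_integral_real_affine) auto
  also have "\<dots> = of_real (1 / \<epsilon>) *
      (CLINT z|lborel. of_real (sqrt (2 * pi)) * (iexp (t / \<epsilon> * z) * of_real (std_normal_density z)))"
    unfolding scaleR_conv_of_real gaussian_eq_std_normal
    by (rule arg_cong2[where f="(*)"], use assms in simp, rule Bochner_Integration.integral_cong)
       (use assms in \<open>simp_all add: mult_ac\<close>)
  also have "\<dots> = of_real (sqrt (2 * pi) / \<epsilon> * exp (- (t / \<epsilon>)\<^sup>2 / 2))"
    by (subst integral_mult_right_zero, subst fourier_std_normal) simp
  finally show ?thesis .
qed

text \<open>Parseval's formula with a Gaussian cutoff. Without the cutoff the left-hand side need not converge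
  for integrable functions; with it, two applications of the multiplication formula move both
  transforms onto the Gaussian, whose transform is again a Gaussian, of width \<open>\<epsilon>\<close> and centred at \<open>s\<close>. So
  the right-hand side pairs \<open>u\<close> with the average of \<open>v\<close> under a normal perturbation of size \<open>\<epsilon>\<close>.\<close>

lemma gauss_parseval:
  assumes u: "integrable lborel u" and v: "integrable lborel v" and \<epsilon>: "\<epsilon> > 0"
  shows "(CLINT x|lborel. fourier u x * cnj (fourier v x) * of_real (exp (- (\<epsilon> * x)\<^sup>2 / 2)))
    = 2 * pi * (CLINT s|lborel. u s * cnj (CLINT z|lborel. of_real (std_normal_density z) * v (s + \<epsilon> * z)))"
proof -
  define w :: "real \<Rightarrow> complex" where "w x = of_real (exp (- (\<epsilon> * x)\<^sup>2 / 2))" for x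
  have w: "integrable lborel w"
    unfolding w_def using integrable_gaussian[OF \<epsilon>] by (rule integrable_of_real)
  note [measurable] = u v w
  have vw: "integrable lborel (\<lambda>x. cnj (fourier v x) * w x)"
    using integrable_fourier_mult[of "\<lambda>t. cnj (v t)" "\<lambda>x. w (0 + (-1) * x)"] v
      lborel_integrable_real_affine[OF w, of "-1" 0]
      lborel_integrable_real_affine[of "\<lambda>x. fourier (\<lambda>t. cnj (v t)) x * w (0 + (-1) * x)" "-1" 0]
    by (simp add: cnj_fourier)
  \<comment> \<open>the transform of v moved onto the shifted Gaussian\<close>
  have inner: "fourier (\<lambda>x. cnj (fourier v x) * w x) s
      = 2 * pi * cnj (CLINT z|lborel. of_real (std_normal_density z) * v (s + \<epsilon> * z))" for s
  proof -
    have density: "sqrt (2 * pi) / \<epsilon> * exp (- ((s + \<epsilon> * z - s) / \<epsilon>)\<^sup>2 / 2)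
        = 2 * pi / \<epsilon> * std_normal_density z" for z
    proof -
      have "sqrt (2 * pi) * (sqrt (2 * pi) * std_normal_density z) = 2 * pi * std_normal_density z"
        by (simp flip: mult.assoc)
      moreover have "(s + \<epsilon> * z - s) / \<epsilon> = 1 * z" using \<epsilon> by simp
      ultimately show ?thesis
        using gaussian_eq_std_normal[of 1 z] by (simp only: times_divide_eq_left mult_1)
    qed
    have shift: "iexp (x * t) * iexp ((- s) * x) = iexp (x * (t - s))" for x t
      unfolding exp_add[symmetric] by (rule arg_cong[where f=exp]) (simp add: algebra_simps)
    have "fourier (\<lambda>x. cnj (fourier v x) * w x) s
        = cnj (CLINT x|lborel. fourier v x * (iexp ((- s) * x) * w x))"
      unfolding fourier_def[of "\<lambda>x. cnj (fourier v x) * w x"]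
      by (subst Bochner_Integration.integral_cnj[symmetric], intro Bochner_Integration.integral_cong refl) (simp add: w_def exp_cnj mult_ac)
    also have "(CLINT x|lborel. fourier v x * (iexp ((- s) * x) * w x))
        = (CLINT t|lborel. v t * fourier (\<lambda>x. iexp ((- s) * x) * w x) t)"
      by (intro fourier_multiplication_formula v integrable_iexp_mult w)
    also have "(\<lambda>t. fourier (\<lambda>x. iexp ((- s) * x) * w x) t) = (\<lambda>t. fourier w (t - s))"
      unfolding fourier_def
      by (intro ext Bochner_Integration.integral_cong refl) (simp only: shift mult.assoc[symmetric])
    also have "(CLINT t|lborel. v t * fourier w (t - s))
        = (CLINT t|lborel. v t * of_real (sqrt (2 * pi) / \<epsilon> * exp (- ((t - s) / \<epsilon>)\<^sup>2 / 2)))"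
      unfolding w_def fourier_gaussian[OF \<epsilon>] ..
    also have "\<dots> = \<bar>\<epsilon>\<bar> *\<^sub>R (CLINT z|lborel. v (s + \<epsilon> * z) *
          of_real (sqrt (2 * pi) / \<epsilon> * exp (- ((s + \<epsilon> * z - s) / \<epsilon>)\<^sup>2 / 2)))"
      using \<epsilon> by (intro lborel_integral_real_affine) auto
    also have "\<dots> = of_real \<epsilon> * (CLINT z|lborel. of_real (2 * pi / \<epsilon>) *
           (of_real (std_normal_density z) * v (s + \<epsilon> * z)))"
      unfolding scaleR_conv_of_real density
      by (rule arg_cong2[where f="(*)"], use \<epsilon> in simp, rule Bochner_Integration.integral_cong)
         (simp, subst of_real_mult, rule trans[OF mult.commute], simp only: mult.assoc)
    also have "\<dots> = 2 * pi * (CLINT z|lborel. of_real (std_normal_density z) * v (s + \<epsilon> * z))"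
      using \<epsilon> by (subst integral_mult_right_zero) simp
    finally show ?thesis by simp
  qed
  have "(CLINT x|lborel. fourier u x * cnj (fourier v x) * of_real (exp (- (\<epsilon> * x)\<^sup>2 / 2)))
    = (CLINT x|lborel. fourier u x * (cnj (fourier v x) * w x))"
    by (simp add: w_def mult.assoc)
  also have "\<dots> = (CLINT s|lborel. u s * fourier (\<lambda>x. cnj (fourier v x) * w x) s)"
    by (intro fourier_multiplication_formula u vw)
  also have "\<dots> = 2 * pi * (CLINT s|lborel. u s * cnj (CLINT z|lborel. of_real (std_normal_density z) * v (s + \<epsilon> * z)))"
    by (subst inner, subst integral_mult_right_zero[symmetric])
       (intro Bochner_Integration.integral_cong refl, simp)
  finally show ?thesis .
qed

section \<open>Plancherel's inequality and Parseval's formula\<close>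

text \<open>Holds without integrability because a Bochner integral that does not exist is \<open>0\<close>.\<close>

lemma norm_integral_le_nn_integral:
  fixes f :: "'a \<Rightarrow> 'b::{banach, second_countable_topology}"
  shows "ennreal (norm (integral\<^sup>L M f)) \<le> (\<integral>\<^sup>+x. ennreal (norm (f x)) \<partial>M)"
  by (cases "integrable M f") (auto intro: integral_norm_bound_ennreal simp: not_integrable_integral_eq)

lemma nn_integral_std_normal [simp]: "(\<integral>\<^sup>+z. ennreal (std_normal_density z) \<partial>lborel) = 1"
  by (subst nn_integral_eq_integral) (auto simp: normal_density_nonneg)

text \<open>Put \<open>v = u\<close> in the Gaussian Parseval formula. By $ab \le (a^2 + b^2)/2$ and translation invariance the
  right-hand side is at most $2\pi\|u\|_2^2$ for every \<open>\<epsilon>\<close>, and Fatou's lemma removes the cutoff.\<close>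

theorem plancherel_le:
  assumes u: "integrable lborel u"
  shows "(\<integral>\<^sup>+x. ennreal ((cmod (fourier u x))\<^sup>2) \<partial>lborel)
    \<le> ennreal (2 * pi) * (\<integral>\<^sup>+t. ennreal ((cmod (u t))\<^sup>2) \<partial>lborel)"
    (is "_ \<le> ennreal (2 * pi) * ?E")
proof -
  have [measurable]: "u \<in> borel_measurable borel" using u by auto
  note [measurable] = borel_measurable_fourier[OF u]
  define w :: "real \<Rightarrow> real \<Rightarrow> real" where "w \<epsilon> x = exp (- (\<epsilon> * x)\<^sup>2 / 2)" for \<epsilon> x
  have [measurable]: "w \<epsilon> \<in> borel_measurable borel" for \<epsilon> unfolding w_def by measurable
  \<comment> \<open>a bound independent of the width of the cutoff, so that the cutoff can be sent to 1\<close>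
  have smoothed: "(\<integral>\<^sup>+x. ennreal ((cmod (fourier u x))\<^sup>2 * w \<epsilon> x) \<partial>lborel) \<le> ennreal (2 * pi) * ?E"
    if \<epsilon>: "\<epsilon> > 0" for \<epsilon>
  proof -
    have w: "integrable lborel (w \<epsilon>)" unfolding w_def by (rule integrable_gaussian[OF \<epsilon>])
    have shift: "(\<integral>\<^sup>+s. ennreal ((cmod (u (s + \<epsilon> * z)))\<^sup>2) \<partial>lborel) = ?E" for z
      using nn_integral_real_affine[of "\<lambda>s. ennreal ((cmod (u s))\<^sup>2)" 1 "\<epsilon> * z"] by (simp add: add.commute)
    have "(\<integral>\<^sup>+x. ennreal ((cmod (fourier u x))\<^sup>2 * w \<epsilon> x) \<partial>lborel)
        = (\<integral>\<^sup>+x. ennreal (norm (fourier u x * cnj (fourier u x) * of_real (w \<epsilon> x))) \<partial>lborel)"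
      by (simp add: norm_mult power2_eq_square w_def)
    also have "\<dots> = ennreal (\<integral>x. norm (fourier u x * cnj (fourier u x) * of_real (w \<epsilon> x)) \<partial>lborel)"
    proof (intro nn_integral_eq_integral integrable_norm)
      show "integrable lborel (\<lambda>x. fourier u x * cnj (fourier u x) * of_real (w \<epsilon> x))"
      proof (rule Bochner_Integration.integrable_bound)
        define B where "B = (\<integral>t. cmod (u t) \<partial>lborel)"
        have "B \<ge> 0" unfolding B_def by simp
        then show "AE x in lborel. norm (fourier u x * cnj (fourier u x) * of_real (w \<epsilon> x)) \<le> norm (B * B * w \<epsilon> x)"
          using norm_fourier_le[OF u] unfolding B_def[symmetric]
          by (intro AE_I2) (auto simp: norm_mult abs_mult intro!: mult_right_mono mult_mono)
        show "integrable lborel (\<lambda>x. B * B * w \<epsilon> x)" using w by auto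
      qed measurable
    qed auto
    also have "\<dots> = ennreal (cmod (CLINT x|lborel. fourier u x * cnj (fourier u x) * of_real (w \<epsilon> x)))"
    proof -
      have "fourier u x * cnj (fourier u x) * of_real (w \<epsilon> x)
          = of_real (norm (fourier u x * cnj (fourier u x) * of_real (w \<epsilon> x)))" for x
        by (simp add: norm_mult complex_norm_square[symmetric] power2_eq_square w_def)
      then have "(CLINT x|lborel. fourier u x * cnj (fourier u x) * of_real (w \<epsilon> x))
          = of_real (\<integral>x. norm (fourier u x * cnj (fourier u x) * of_real (w \<epsilon> x)) \<partial>lborel)"
        by (metis (no_types, lifting) Bochner_Integration.integral_cong integral_complex_of_real)
      then show ?thesis by simp
    qed
    also have "\<dots> = ennreal (2 * pi) * ennreal (cmod (CLINT s|lborel. u s *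
         cnj (CLINT z|lborel. of_real (std_normal_density z) * u (s + \<epsilon> * z))))"
      unfolding w_def gauss_parseval[OF u u \<epsilon>] norm_mult by (simp add: ennreal_mult)
    also have "\<dots> \<le> ennreal (2 * pi) * ?E"
    proof (rule mult_left_mono)
      have amgm: "ennreal (cmod (u s)) * (ennreal (std_normal_density z) * ennreal (cmod (u (s + \<epsilon> * z))))
          \<le> ennreal (std_normal_density z / 2) * (ennreal ((cmod (u s))\<^sup>2) + ennreal ((cmod (u (s + \<epsilon> * z)))\<^sup>2))" for s z
      proof -
        have "cmod (u s) * cmod (u (s + \<epsilon> * z)) \<le> ((cmod (u s))\<^sup>2 + (cmod (u (s + \<epsilon> * z)))\<^sup>2) / 2"
          using sum_squares_bound[of "cmod (u s)" "cmod (u (s + \<epsilon> * z))"] by simp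
        then have "std_normal_density z * (cmod (u s) * cmod (u (s + \<epsilon> * z)))
            \<le> std_normal_density z * (((cmod (u s))\<^sup>2 + (cmod (u (s + \<epsilon> * z)))\<^sup>2) / 2)"
          by (intro mult_left_mono) auto
        then show ?thesis
          by (simp add: ennreal_mult[symmetric] ennreal_plus[symmetric] mult_ac del: ennreal_plus)
      qed
      have "ennreal (cmod (CLINT s|lborel. u s * cnj (CLINT z|lborel. of_real (std_normal_density z) * u (s + \<epsilon> * z))))
          \<le> (\<integral>\<^sup>+s. ennreal (norm (u s * cnj (CLINT z|lborel. of_real (std_normal_density z) * u (s + \<epsilon> * z)))) \<partial>lborel)"
        by (rule norm_integral_le_nn_integral)
      also have "\<dots> = (\<integral>\<^sup>+s. ennreal (cmod (u s)) * ennreal (cmod (CLINT z|lborel. of_real (std_normal_density z) * u (s + \<epsilon> * z))) \<partial>lborel)"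
        by (simp add: norm_mult ennreal_mult)
      also have "\<dots> \<le> (\<integral>\<^sup>+s. ennreal (cmod (u s)) * (\<integral>\<^sup>+z. ennreal (std_normal_density z) * ennreal (cmod (u (s + \<epsilon> * z))) \<partial>lborel) \<partial>lborel)"
        using norm_integral_le_nn_integral[of lborel "\<lambda>z. of_real (std_normal_density z) * u (s + \<epsilon> * z)" for s]
        by (intro nn_integral_mono mult_left_mono) (auto simp: norm_mult ennreal_mult)
      also have "\<dots> = (\<integral>\<^sup>+s. \<integral>\<^sup>+z. ennreal (cmod (u s)) * (ennreal (std_normal_density z) * ennreal (cmod (u (s + \<epsilon> * z)))) \<partial>lborel \<partial>lborel)"
        by (subst nn_integral_cmult) auto
      also have "\<dots> \<le> (\<integral>\<^sup>+s. \<integral>\<^sup>+z. ennreal (std_normal_density z / 2) * (ennreal ((cmod (u s))\<^sup>2) + ennreal ((cmod (u (s + \<epsilon> * z)))\<^sup>2)) \<partial>lborel \<partial>lborel)"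
        by (intro nn_integral_mono amgm)
      also have "\<dots> = (\<integral>\<^sup>+z. \<integral>\<^sup>+s. ennreal (std_normal_density z / 2) * (ennreal ((cmod (u s))\<^sup>2) + ennreal ((cmod (u (s + \<epsilon> * z)))\<^sup>2)) \<partial>lborel \<partial>lborel)"
        by (rule lborel_pair.Fubini') measurable
      also have "\<dots> = (\<integral>\<^sup>+z. ennreal (std_normal_density z / 2) * (?E + ?E) \<partial>lborel)"
        by (subst nn_integral_cmult, measurable, subst nn_integral_add) (auto simp: shift)
      also have "\<dots> = (\<integral>\<^sup>+z. ennreal (std_normal_density z) * ?E \<partial>lborel)"
      proof (intro nn_integral_cong)
        fix z :: real
        have "ennreal (std_normal_density z / 2) * (?E + ?E) = ennreal (std_normal_density z / 2) * 2 * ?E"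
          by (simp add: mult_2 mult.assoc)
        also have "ennreal (std_normal_density z / 2) * 2 = ennreal (std_normal_density z / 2 * 2)"
          by (subst ennreal_mult) auto
        finally show "ennreal (std_normal_density z / 2) * (?E + ?E) = ennreal (std_normal_density z) * ?E" by simp
      qed
      also have "\<dots> = ?E"
        by (subst nn_integral_multc) auto
      finally show "ennreal (cmod (CLINT s|lborel. u s * cnj (CLINT z|lborel. of_real (std_normal_density z) * u (s + \<epsilon> * z)))) \<le> ?E" .
    qed auto
    finally show ?thesis .
  qed
  have "(\<integral>\<^sup>+x. ennreal ((cmod (fourier u x))\<^sup>2) \<partial>lborel)
      = (\<integral>\<^sup>+x. liminf (\<lambda>n. ennreal ((cmod (fourier u x))\<^sup>2 * w (1 / real (Suc n)) x)) \<partial>lborel)"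
  proof (intro nn_integral_cong lim_imp_Liminf[symmetric])
    fix x
    have "(\<lambda>n. exp (- ((1 / real (Suc n)) * x)\<^sup>2 / 2)) \<longlonglongrightarrow> exp (- (0 * x)\<^sup>2 / 2)"
      using LIMSEQ_inverse_real_of_nat unfolding inverse_eq_divide by (intro tendsto_intros) auto
    then have "(\<lambda>n. (cmod (fourier u x))\<^sup>2 * w (1 / real (Suc n)) x) \<longlonglongrightarrow> (cmod (fourier u x))\<^sup>2 * 1"
      unfolding w_def by (intro tendsto_intros) simp
    then show "(\<lambda>n. ennreal ((cmod (fourier u x))\<^sup>2 * w (1 / real (Suc n)) x)) \<longlonglongrightarrow> ennreal ((cmod (fourier u x))\<^sup>2)"
      by (intro tendsto_ennrealI) simp
  qed simp
  also have "\<dots> \<le> liminf (\<lambda>n. \<integral>\<^sup>+x. ennreal ((cmod (fourier u x))\<^sup>2 * w (1 / real (Suc n)) x) \<partial>lborel)"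
    by (intro nn_integral_liminf) measurable
  also have "\<dots> \<le> liminf (\<lambda>n. ennreal (2 * pi) * ?E)"
    using smoothed by (intro Liminf_mono always_eventually) auto
  also have "\<dots> = ennreal (2 * pi) * ?E"
    by (simp add: Liminf_const)
  finally show ?thesis .
qed

text \<open>When the product of the transforms is integrable, \<open>\<epsilon> \<rightarrow> 0\<close> is allowed on both sides of the Gaussian
  Parseval formula by dominated convergence. Continuity and boundedness of \<open>v\<close> make its Gaussian
  averages converge at every point.\<close>

lemma parseval_continuous:
  assumes u: "integrable lborel u" and v: "integrable lborel v"
    and cont: "\<And>x. isCont v x" and bounded: "\<And>x. cmod (v x) \<le> B"
    and int: "integrable lborel (\<lambda>x. fourier u x * cnj (fourier v x))"
  shows "(CLINT x|lborel. fourier u x * cnj (fourier v x)) = 2 * pi * (CLINT s|lborel. u s * cnj (v s))"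
proof (rule LIMSEQ_unique)
  have [measurable]: "u \<in> borel_measurable borel" "v \<in> borel_measurable borel" using u v by auto
  note [measurable] = borel_measurable_fourier[OF u] borel_measurable_fourier[OF v]
  define e where "e n = 1 / real (Suc n)" for n
  have e: "e \<longlonglongrightarrow> 0" "\<And>n. e n > 0"
    unfolding e_def using LIMSEQ_inverse_real_of_nat by (auto simp: inverse_eq_divide)
  let ?L = "\<lambda>n. CLINT x|lborel. fourier u x * cnj (fourier v x) * of_real (exp (- (e n * x)\<^sup>2 / 2))"
  show "?L \<longlonglongrightarrow> (CLINT x|lborel. fourier u x * cnj (fourier v x))"
  proof (rule integral_dominated_convergence[where w="\<lambda>x. norm (fourier u x * cnj (fourier v x))"])
    show "AE x in lborel. (\<lambda>n. fourier u x * cnj (fourier v x) * of_real (exp (- (e n * x)\<^sup>2 / 2)))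
        \<longlonglongrightarrow> fourier u x * cnj (fourier v x)"
    proof (intro AE_I2)
      fix x
      have "(\<lambda>n. fourier u x * cnj (fourier v x) * of_real (exp (- (e n * x)\<^sup>2 / 2)))
        \<longlonglongrightarrow> fourier u x * cnj (fourier v x) * of_real (exp (- (0 * x)\<^sup>2 / 2))"
        using e(1) by (intro tendsto_intros) auto
      then show "(\<lambda>n. fourier u x * cnj (fourier v x) * of_real (exp (- (e n * x)\<^sup>2 / 2)))
        \<longlonglongrightarrow> fourier u x * cnj (fourier v x)" by simp
    qed
    show "AE x in lborel. norm (fourier u x * cnj (fourier v x) * of_real (exp (- (e n * x)\<^sup>2 / 2)))
      \<le> norm (fourier u x * cnj (fourier v x))" for n
      by (intro AE_I2) (simp add: norm_mult mult_left_le)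
  qed (use int in auto)
  let ?V = "\<lambda>n s. CLINT z|lborel. of_real (std_normal_density z) * v (s + e n * z)"
  have V: "(\<lambda>n. ?V n s) \<longlonglongrightarrow> v s" for s
  proof -
    have "(\<lambda>n. ?V n s) \<longlonglongrightarrow> (CLINT z|lborel. of_real (std_normal_density z) * v s)"
    proof (rule integral_dominated_convergence[where w="\<lambda>z. std_normal_density z * B"])
      show "AE z in lborel. (\<lambda>n. of_real (std_normal_density z) * v (s + e n * z))
          \<longlonglongrightarrow> of_real (std_normal_density z) * v s"
      proof (intro AE_I2 tendsto_intros)
        fix z
        have "(\<lambda>n. s + e n * z) \<longlonglongrightarrow> s + 0 * z" using e(1) by (intro tendsto_intros)
        then show "(\<lambda>n. v (s + e n * z)) \<longlonglongrightarrow> v s"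
          using isCont_tendsto_compose[OF cont[of s]] by simp
      qed
      show "AE z in lborel. norm (of_real (std_normal_density z) * v (s + e n * z)) \<le> std_normal_density z * B" for n
        using bounded by (intro AE_I2) (auto simp: norm_mult intro!: mult_left_mono)
    qed auto
    moreover have "(CLINT z|lborel. of_real (std_normal_density z) * v s) = v s"
      by (subst integral_mult_left_zero) (simp add: integral_complex_of_real)
    ultimately show ?thesis by simp
  qed
  have "norm (?V n s) \<le> B" for n s
  proof -
    have "norm (?V n s) \<le> (\<integral>z. norm (of_real (std_normal_density z) * v (s + e n * z)) \<partial>lborel)"
      by (rule integral_norm_bound)
    also have "\<dots> \<le> (\<integral>z. std_normal_density z * B \<partial>lborel)"
    proof (intro integral_mono)
      have le: "norm (of_real (std_normal_density z) * v (s + e n * z)) \<le> std_normal_density z * B" for z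
        using bounded by (auto simp: norm_mult intro!: mult_left_mono)
      then show "norm (of_real (std_normal_density z) * v (s + e n * z)) \<le> std_normal_density z * B" for z .
      show "integrable lborel (\<lambda>z. norm (of_real (std_normal_density z) * v (s + e n * z)))"
        by (rule Bochner_Integration.integrable_bound[of _ "\<lambda>z. std_normal_density z * B"], simp, measurable)
           (rule AE_I2, use order_trans[OF le abs_ge_self] in simp)
    qed simp
    also have "\<dots> = B" by simp
    finally show ?thesis .
  qed
  note V_le = this
  have "(\<lambda>n. CLINT s|lborel. u s * cnj (?V n s)) \<longlonglongrightarrow> (CLINT s|lborel. u s * cnj (v s))"
  proof (rule integral_dominated_convergence[where w="\<lambda>s. norm (u s) * B"])
    show "AE s in lborel. (\<lambda>n. u s * cnj (?V n s)) \<longlonglongrightarrow> u s * cnj (v s)"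
      using V by (intro AE_I2 tendsto_intros)
    show "AE s in lborel. norm (u s * cnj (?V n s)) \<le> norm (u s) * B" for n
      using V_le by (intro AE_I2) (auto simp: norm_mult intro!: mult_left_mono)
  qed (use u in auto)
  then have "(\<lambda>n. 2 * pi * (CLINT s|lborel. u s * cnj (?V n s))) \<longlonglongrightarrow> 2 * pi * (CLINT s|lborel. u s * cnj (v s))"
    by (intro tendsto_intros)
  then show "?L \<longlonglongrightarrow> 2 * pi * (CLINT s|lborel. u s * cnj (v s))"
    by (simp only: gauss_parseval[OF u v e(2)])
qed

section \<open>Fourier decay from a square integrable derivative\<close>

definition difference_quotient :: "real \<Rightarrow> (real \<Rightarrow> real) \<Rightarrow> real \<Rightarrow> real" where
  "difference_quotient s f x = (f (x + s) - f x) / s"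

lemma integrable_difference_quotient:
  assumes "integrable lborel f"
  shows "integrable lborel (difference_quotient s f)"
  using assms lborel_integrable_real_affine[OF assms, of 1 s]
  unfolding difference_quotient_def[abs_def] by (simp add: add.commute)

lemma integrable_difference_quotient_pow:
  assumes "integrable lborel f"
  shows "integrable lborel ((difference_quotient s ^^ m) f)"
  by (induction m) (auto intro: assms integrable_difference_quotient)

text \<open>Difference quotients replace derivatives here because \<open>f\<close> integrable passes to them, whereas \<open>f'\<close> may
  fail to be integrable and then has no transform in the present sense.\<close>

lemma fourier_difference_quotient:
  assumes f: "integrable lborel f"
  shows "fourier (\<lambda>x. of_real (difference_quotient s f x)) t
    = (iexp (- s * t) - 1) / of_real s * fourier (\<lambda>x. of_real (f x)) t"
proof -
  let ?f = "\<lambda>x. complex_of_real (f x)"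
  have f': "integrable lborel ?f" using f by simp
  have "integrable lborel (\<lambda>x. ?f (s + 1 * x))"
    by (intro lborel_integrable_real_affine f') simp
  then have fs: "integrable lborel (\<lambda>x. ?f (x + s))" by (simp add: add.commute)
  have e: "iexp ((x - s) * t) = iexp (- s * t) * iexp (x * t)" for x
    unfolding exp_add[symmetric] by (rule arg_cong[where f=exp]) (simp add: algebra_simps)
  have "(CLINT x|lborel. iexp (x * t) * ?f (x + s)) = \<bar>1\<bar> *\<^sub>R (CLINT x|lborel. iexp ((- s + 1 * x) * t) * ?f ((- s + 1 * x) + s))"
    by (rule lborel_integral_real_affine) simp
  also have "\<dots> = (CLINT x|lborel. iexp (- s * t) * (iexp (x * t) * ?f x))"
    using e by (simp add: mult.assoc)
  also have "\<dots> = iexp (- s * t) * fourier ?f t"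
    unfolding fourier_def by (rule integral_mult_right_zero)
  finally have shift: "(CLINT x|lborel. iexp (x * t) * ?f (x + s)) = iexp (- s * t) * fourier ?f t" .
  have "fourier (\<lambda>x. of_real (difference_quotient s f x)) t
      = (CLINT x|lborel. (iexp (x * t) * ?f (x + s) - iexp (x * t) * ?f x) / of_real s)"
    unfolding fourier_def difference_quotient_def
    by (intro Bochner_Integration.integral_cong refl) (simp add: right_diff_distrib)
  also have "\<dots> = ((CLINT x|lborel. iexp (x * t) * ?f (x + s)) - (CLINT x|lborel. iexp (x * t) * ?f x)) / of_real s"
    using integrable_iexp_mult(2)[OF fs] integrable_iexp_mult(2)[OF f']
    by (subst integral_divide_zero) (simp add: Bochner_Integration.integral_diff)
  also have "\<dots> = (iexp (- s * t) - 1) / of_real s * fourier ?f t"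
    unfolding shift fourier_def[symmetric] by (simp add: left_diff_distrib)
  finally show ?thesis .
qed

lemma fourier_difference_quotient_pow:
  assumes f: "integrable lborel f"
  shows "fourier (\<lambda>x. of_real ((difference_quotient s ^^ m) f x)) t
    = ((iexp (- s * t) - 1) / of_real s) ^ m * fourier (\<lambda>x. of_real (f x)) t"
proof (induction m)
  case (Suc m)
  show ?case
    using fourier_difference_quotient[OF integrable_difference_quotient_pow[OF f]] Suc
    by (simp add: mult.assoc)
qed simp

lemma difference_quotient_has_derivative:
  assumes "\<And>x. (f has_real_derivative f' x) (at x)"
  shows "(difference_quotient s f has_real_derivative difference_quotient s f' x) (at x)"
  unfolding difference_quotient_def[abs_def]
  by (intro DERIV_cdivide DERIV_diff DERIV_shift[THEN iffD1] assms)

lemma difference_quotient_pow_has_derivative: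
  assumes "\<And>x. (f has_real_derivative f' x) (at x)"
  shows "((difference_quotient s ^^ m) f has_real_derivative (difference_quotient s ^^ m) f' x) (at x)"
proof (induction m arbitrary: x)
  case 0
  show ?case using assms[of x] by simp
next
  case (Suc m)
  show ?case using difference_quotient_has_derivative[OF Suc] by simp
qed

text \<open>The Cauchy-Schwarz inequality against the constant \<open>1\<close>, obtained from $\int (g - c)^2 \ge 0$ where \<open>c\<close> is
  the mean value of \<open>g\<close>.\<close>

lemma set_integral_square_le:
  fixes g :: "real \<Rightarrow> real"
  assumes g: "set_integrable lborel {a..b} g" and g2: "set_integrable lborel {a..b} (\<lambda>x. (g x)\<^sup>2)"
    and ab: "a < b"
  shows "(LINT x:{a..b}|lborel. g x)\<^sup>2 \<le> (b - a) * (LINT x:{a..b}|lborel. (g x)\<^sup>2)"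
proof -
  define I where "I = (LINT x:{a..b}|lborel. g x)"
  define c where "c = I / (b - a)"
  have one: "set_integrable lborel {a..b} (\<lambda>x. c\<^sup>2)"
    unfolding set_integrable_def by (intro integrable_scaleR_left integrable_real_indicator) (auto simp: ab less_imp_le)
  have one': "(LINT x:{a..b}|lborel. c\<^sup>2) = c\<^sup>2 * (b - a)"
    using ab set_integral_const[of "{a..b}" lborel "c\<^sup>2"] by simp
  have lin: "set_integrable lborel {a..b} (\<lambda>x. (- 2 * c) * g x)"
    by (rule set_integrable_mult_right[OF g])
  have eq: "(g x - c)\<^sup>2 = (g x)\<^sup>2 + (- 2 * c) * g x + c\<^sup>2" for x
    by (simp add: power2_eq_square algebra_simps)
  have "0 \<le> (LINT x:{a..b}|lborel. (g x - c)\<^sup>2)"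
    unfolding set_lebesgue_integral_def by (intro Bochner_Integration.integral_nonneg) simp
  also have "\<dots> = (LINT x:{a..b}|lborel. (g x)\<^sup>2) + (- 2 * c) * I + c\<^sup>2 * (b - a)"
    unfolding eq I_def set_integral_add(2)[OF set_integral_add(1)[OF g2 lin] one]
      set_integral_add(2)[OF g2 lin] one' set_integral_mult_right ..
  finally have "0 \<le> (b - a) * ((LINT x:{a..b}|lborel. (g x)\<^sup>2) + (- 2 * c) * I + c\<^sup>2 * (b - a))"
    using ab by simp
  also have "\<dots> = (b - a) * (LINT x:{a..b}|lborel. (g x)\<^sup>2) - I\<^sup>2"
  proof -
    have "c * (b - a) = I" using ab unfolding c_def by simp
    moreover have "(b - a) * ((- 2 * c) * I + c\<^sup>2 * (b - a)) = (c * (b - a))\<^sup>2 - 2 * (c * (b - a)) * I"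
      by (simp add: power2_eq_square algebra_simps)
    ultimately have "(b - a) * ((- 2 * c) * I + c\<^sup>2 * (b - a)) = - I\<^sup>2"
      by (simp add: power2_eq_square)
    then show ?thesis by (simp only: add.assoc distrib_left[of "b - a" "LINT x:{a..b}|lborel. (g x)\<^sup>2"])
  qed
  finally show ?thesis unfolding I_def by simp
qed

text \<open>The difference quotient at \<open>x\<close> is the mean of \<open>g'\<close> over \<open>{x..x + s}\<close>, so its square is at most the mean
  of the square of \<open>g'\<close>, and averaging over translates preserves the integral. The fundamental theorem is
  used for a derivative that need not be continuous: the gauge integral of \<open>g'\<close> exists, and it is a
  Lebesgue integral since \<open>g'\<close> is locally square integrable.\<close>

lemma nn_integral_difference_quotient_le:
  fixes g g' :: "real \<Rightarrow> real"
  assumes deriv: "\<And>x. (g has_real_derivative g' x) (at x)"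
    and [measurable]: "g' \<in> borel_measurable borel" and s: "s > 0"
  shows "(\<integral>\<^sup>+x. ennreal ((difference_quotient s g x)\<^sup>2) \<partial>lborel) \<le> (\<integral>\<^sup>+x. ennreal ((g' x)\<^sup>2) \<partial>lborel)"
proof (cases "(\<integral>\<^sup>+x. ennreal ((g' x)\<^sup>2) \<partial>lborel) = \<infinity>")
  case False
  have sq: "integrable lborel (\<lambda>x. (g' x)\<^sup>2)"
    using False by (intro integrableI_bounded) (simp_all add: less_top)
  have sq_on: "set_integrable lborel {a..b} (\<lambda>x. (g' x)\<^sup>2)" for a b
    using integrable_mult_indicator[OF _ sq, of "{a..b}"] unfolding set_integrable_def by auto
  have int_on: "set_integrable lborel {a..b} g'" for a b
  proof -
    have "set_integrable lborel {a..b} (\<lambda>x. 1 + (g' x)\<^sup>2)"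
    proof (rule set_integral_add(1)[OF _ sq_on])
      show "set_integrable lborel {a..b} (\<lambda>x. 1 :: real)"
        unfolding set_integrable_def
        by (intro integrable_scaleR_left integrable_real_indicator) (simp_all add: emeasure_lborel_Icc_eq)
    qed
    then show ?thesis
      unfolding set_integrable_def
    proof (rule Bochner_Integration.integrable_bound)
      \<comment> \<open>the constant 1 is integrable on a bounded interval, so this bound makes the derivative integrable there\<close>
      have "\<bar>y\<bar> \<le> 1 + y\<^sup>2" for y :: real
        using sum_squares_bound[of "\<bar>y\<bar>" 1] by simp
      then show "AE x in lborel. norm (indicator {a..b} x *\<^sub>R g' x) \<le> norm (indicator {a..b} x *\<^sub>R (1 + (g' x)\<^sup>2))"
        by (intro AE_I2) (auto split: split_indicator intro: order_trans[OF _ abs_ge_self])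
    qed measurable
  qed
  have pointwise: "ennreal ((difference_quotient s g x)\<^sup>2)
      \<le> ennreal (1 / s) * (\<integral>\<^sup>+y. ennreal ((g' y)\<^sup>2) * indicator {x..x+s} y \<partial>lborel)" for x
  proof -
    have "(g' has_integral (g (x + s) - g x)) {x..x+s}"
      using s deriv by (intro fundamental_theorem_of_calculus)
        (auto simp: has_real_derivative_iff_has_vector_derivative[symmetric] intro: DERIV_subset)
    then have "integral {x..x+s} g' = g (x + s) - g x" by (rule integral_unique)
    moreover have "(LINT y:{x..x+s}|lborel. g' y) = integral {x..x+s} g'"
      by (rule set_borel_integral_eq_integral(2)[OF int_on])
    ultimately have ftc: "(LINT y:{x..x+s}|lborel. g' y) = g (x + s) - g x" by simp
    have "(difference_quotient s g x)\<^sup>2 = (g (x + s) - g x)\<^sup>2 / s\<^sup>2"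
      by (simp add: difference_quotient_def power_divide)
    also have "\<dots> \<le> (s * (LINT y:{x..x+s}|lborel. (g' y)\<^sup>2)) / s\<^sup>2"
      using set_integral_square_le[OF int_on sq_on, of x "x + s"] s ftc by (intro divide_right_mono) auto
    also have "\<dots> = 1 / s * (LINT y:{x..x+s}|lborel. (g' y)\<^sup>2)"
      using s by (simp add: power2_eq_square)
    finally have "ennreal ((difference_quotient s g x)\<^sup>2) \<le> ennreal (1 / s * (LINT y:{x..x+s}|lborel. (g' y)\<^sup>2))"
      by (rule ennreal_leI)
    also have "\<dots> = ennreal (1 / s) * ennreal (LINT y:{x..x+s}|lborel. (g' y)\<^sup>2)"
      using s by (intro ennreal_mult') simp
    also have "ennreal (LINT y:{x..x+s}|lborel. (g' y)\<^sup>2) = (\<integral>\<^sup>+y. ennreal ((g' y)\<^sup>2) * indicator {x..x+s} y \<partial>lborel)"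
      using sq_on unfolding set_integrable_def set_lebesgue_integral_def
      by (subst nn_integral_eq_integral[symmetric])
         (auto intro!: nn_integral_cong split: split_indicator)
    finally show ?thesis .
  qed
  have "(\<integral>\<^sup>+x. ennreal ((difference_quotient s g x)\<^sup>2) \<partial>lborel)
      \<le> (\<integral>\<^sup>+x. ennreal (1 / s) * (\<integral>\<^sup>+y. ennreal ((g' y)\<^sup>2) * indicator {x..x+s} y \<partial>lborel) \<partial>lborel)"
    by (intro nn_integral_mono pointwise)
  also have "\<dots> = (\<integral>\<^sup>+x. ennreal (1 / s) * (\<integral>\<^sup>+y. ennreal ((g' y)\<^sup>2) * indicator {0..s} (y - x) \<partial>lborel) \<partial>lborel)"
    by (intro nn_integral_cong arg_cong2[where f="(*)"] refl) (auto split: split_indicator)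
  also have "\<dots> = ennreal (1 / s) * (\<integral>\<^sup>+x. (\<integral>\<^sup>+y. ennreal ((g' y)\<^sup>2) * indicator {0..s} (y - x) \<partial>lborel) \<partial>lborel)"
    by (rule nn_integral_cmult) measurable
  also have "(\<integral>\<^sup>+x. (\<integral>\<^sup>+y. ennreal ((g' y)\<^sup>2) * indicator {0..s} (y - x) \<partial>lborel) \<partial>lborel)
      = (\<integral>\<^sup>+y. (\<integral>\<^sup>+x. ennreal ((g' y)\<^sup>2) * indicator {0..s} (y - x) \<partial>lborel) \<partial>lborel)"
    by (rule lborel_pair.Fubini') measurable
  also have "\<dots> = (\<integral>\<^sup>+y. ennreal ((g' y)\<^sup>2) * ennreal s \<partial>lborel)"
  proof (intro nn_integral_cong)
    fix y
    have "(\<integral>\<^sup>+x. ennreal ((g' y)\<^sup>2) * indicator {0..s} (y - x) \<partial>lborel)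
        = (\<integral>\<^sup>+x. ennreal ((g' y)\<^sup>2) * indicator {y-s..y} x \<partial>lborel)"
      by (intro nn_integral_cong) (auto split: split_indicator)
    also have "\<dots> = ennreal ((g' y)\<^sup>2) * ennreal s"
      using s by (simp add: nn_integral_cmult)
    finally show "(\<integral>\<^sup>+x. ennreal ((g' y)\<^sup>2) * indicator {0..s} (y - x) \<partial>lborel) = ennreal ((g' y)\<^sup>2) * ennreal s" .
  qed
  also have "ennreal (1 / s) * \<dots> = (\<integral>\<^sup>+x. ennreal ((g' x)\<^sup>2) \<partial>lborel)"
    using s by (subst nn_integral_cmult[symmetric], measurable, intro nn_integral_cong)
      (simp add: ennreal_mult[symmetric])
  finally show ?thesis .
qed simp

lemma times_differentiable_Suc:
  "times_differentiable (Suc m) f \<longleftrightarrow> (\<forall>x. f differentiable (at x)) \<and> times_differentiable m (deriv f)"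
  unfolding times_differentiable_def All_less_Suc2 funpow_Suc_right comp_apply by simp

lemma borel_measurable_of_times_differentiable:
  assumes "times_differentiable m f" "(deriv ^^ m) f \<in> borel_measurable borel"
  shows "f \<in> borel_measurable borel"
proof (cases m)
  case (Suc k)
  have "f differentiable (at x)" for x
    using assms(1) unfolding Suc times_differentiable_Suc by simp
  then have "continuous_on UNIV f"
    by (auto intro!: continuous_at_imp_continuous_on differentiable_imp_continuous_within)
  then show ?thesis by (rule borel_measurable_continuous_onI)
qed (use assms in simp)

lemma borel_measurable_difference_quotient:
  assumes [measurable]: "f \<in> borel_measurable borel"
  shows "difference_quotient s f \<in> borel_measurable borel"
  unfolding difference_quotient_def[abs_def] by measurable

lemma borel_measurable_difference_quotient_pow:
  assumes "f \<in> borel_measurable borel"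
  shows "(difference_quotient s ^^ m) f \<in> borel_measurable borel"
  by (induction m) (simp_all add: assms borel_measurable_difference_quotient)

lemma nn_integral_difference_quotient_pow_le:
  assumes "times_differentiable m f" "(deriv ^^ m) f \<in> borel_measurable borel" "s > 0"
  shows "(\<integral>\<^sup>+x. ennreal (((difference_quotient s ^^ m) f x)\<^sup>2) \<partial>lborel)
    \<le> (\<integral>\<^sup>+x. ennreal (((deriv ^^ m) f x)\<^sup>2) \<partial>lborel)"
  using assms(1,2)
proof (induction m arbitrary: f)
  case (Suc m)
  have f: "(f has_real_derivative deriv f x) (at x)" for x
    using Suc.prems(1) unfolding times_differentiable_Suc
    by (simp add: DERIV_deriv_iff_real_differentiable)
  have f': "times_differentiable m (deriv f)" "(deriv ^^ m) (deriv f) \<in> borel_measurable borel"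
    using Suc.prems unfolding times_differentiable_Suc funpow_Suc_right by simp_all
  have "(\<integral>\<^sup>+x. ennreal (((difference_quotient s ^^ Suc m) f x)\<^sup>2) \<partial>lborel)
      \<le> (\<integral>\<^sup>+x. ennreal (((difference_quotient s ^^ m) (deriv f) x)\<^sup>2) \<partial>lborel)"
    using nn_integral_difference_quotient_le[OF difference_quotient_pow_has_derivative[OF f]
      borel_measurable_difference_quotient_pow[OF borel_measurable_of_times_differentiable[OF f']] \<open>s > 0\<close>]
    by simp
  also have "\<dots> \<le> (\<integral>\<^sup>+x. ennreal (((deriv ^^ m) (deriv f) x)\<^sup>2) \<partial>lborel)"
    by (rule Suc.IH[OF f'])
  finally show ?case unfolding funpow_Suc_right[of m deriv] comp_apply .
qed simp

text \<open>The function \<open>(difference_quotient s ^^ m) f\<close> is integrable, has transform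
  $((e^{-ist} - 1)/s)^m \hat f(t)$, and its square norm is at most that of \<open>(deriv ^^ m) f\<close>. Plancherel's
  inequality for it, followed by $s \to 0$ and Fatou's lemma, gives the claim, without boundary terms
  and without knowing whether the derivatives of \<open>f\<close> are integrable.\<close>

theorem nn_integral_weighted_fourier_le:
  assumes f: "integrable lborel f" and diff: "times_differentiable m f"
    and meas: "(deriv ^^ m) f \<in> borel_measurable borel"
  shows "(\<integral>\<^sup>+t. ennreal (t ^ (2 * m) * (cmod (fourier (\<lambda>x. of_real (f x)) t))\<^sup>2) \<partial>lborel)
    \<le> ennreal (2 * pi) * (\<integral>\<^sup>+x. ennreal (((deriv ^^ m) f x)\<^sup>2) \<partial>lborel)"
    (is "_ \<le> ?C")
proof -
  let ?F = "fourier (\<lambda>x. of_real (f x))"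
  have [measurable]: "?F \<in> borel_measurable borel"
    using f by (intro borel_measurable_fourier) simp
  define e where "e n = 1 / real (Suc n)" for n
  have e: "e \<longlonglongrightarrow> 0" "\<And>n. e n > 0"
    unfolding e_def using LIMSEQ_inverse_real_of_nat by (auto simp: inverse_eq_divide)
  define q where "q n t = (iexp (- e n * t) - 1) / of_real (e n)" for n t
  have [measurable]: "q n \<in> borel_measurable borel" for n unfolding q_def by measurable
  \<comment> \<open>the difference symbol converges to that of the derivative, by the second order Taylor bound\<close>
  have q: "(\<lambda>n. q n t) \<longlonglongrightarrow> - \<i> * t" for t
  proof -
    have "(\<lambda>n. norm (q n t - (- \<i> * t))) \<longlonglongrightarrow> 0"
    proof (rule tendsto_sandwich[of "\<lambda>_. 0" _ _ "\<lambda>n. e n * (t\<^sup>2 / 2)"])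
      show "\<forall>\<^sub>F n in sequentially. norm (q n t - (- \<i> * t)) \<le> e n * (t\<^sup>2 / 2)"
      proof (intro always_eventually allI)
        fix n
        have "q n t - (- \<i> * t) = (iexp (- e n * t) - (1 + \<i> * (- e n * t))) / of_real (e n)"
          using e(2)[of n] unfolding q_def by (simp add: field_simps)
        then have "norm (q n t - (- \<i> * t)) = norm (iexp (- e n * t) - (1 + \<i> * (- e n * t))) / e n"
          using e(2)[of n] by (simp add: norm_divide)
        also have "\<dots> \<le> ((- e n * t)\<^sup>2 / 2) / e n"
          using iexp_approx1[of "- e n * t" 1] e(2)[of n]
          by (intro divide_right_mono) (auto simp: power2_eq_square)
        also have "\<dots> = e n * (t\<^sup>2 / 2)" using e(2)[of n] by (simp add: power2_eq_square)
        finally show "norm (q n t - (- \<i> * t)) \<le> e n * (t\<^sup>2 / 2)" .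
      qed
      show "(\<lambda>n. e n * (t\<^sup>2 / 2)) \<longlonglongrightarrow> 0"
        using tendsto_mult_right[OF e(1), of "t\<^sup>2 / 2"] by simp
    qed auto
    then show ?thesis unfolding tendsto_norm_zero_iff by (rule LIM_zero_cancel)
  qed
  have le: "(\<integral>\<^sup>+t. ennreal ((cmod (q n t ^ m * ?F t))\<^sup>2) \<partial>lborel) \<le> ?C" for n
  proof -
    have "(\<integral>\<^sup>+t. ennreal ((cmod (q n t ^ m * ?F t))\<^sup>2) \<partial>lborel)
        = (\<integral>\<^sup>+t. ennreal ((cmod (fourier (\<lambda>x. of_real ((difference_quotient (e n) ^^ m) f x)) t))\<^sup>2) \<partial>lborel)"
      unfolding fourier_difference_quotient_pow[OF f] q_def ..
    also have "\<dots> \<le> ennreal (2 * pi) * (\<integral>\<^sup>+x. ennreal ((cmod (of_real ((difference_quotient (e n) ^^ m) f x)))\<^sup>2) \<partial>lborel)"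
      by (intro plancherel_le integrable_of_real integrable_difference_quotient_pow f)
    also have "\<dots> \<le> ?C"
      using nn_integral_difference_quotient_pow_le[OF diff meas e(2)]
      by (intro mult_left_mono) auto
    finally show ?thesis .
  qed
  have "(\<integral>\<^sup>+t. ennreal (t ^ (2 * m) * (cmod (?F t))\<^sup>2) \<partial>lborel)
      = (\<integral>\<^sup>+t. liminf (\<lambda>n. ennreal ((cmod (q n t ^ m * ?F t))\<^sup>2)) \<partial>lborel)"
  proof (intro nn_integral_cong lim_imp_Liminf[symmetric])
    fix t
    have "(\<lambda>n. (cmod (q n t ^ m * ?F t))\<^sup>2) \<longlonglongrightarrow> (cmod ((- \<i> * t) ^ m * ?F t))\<^sup>2"
      by (intro tendsto_intros q)
    also have "(cmod ((- \<i> * t) ^ m * ?F t))\<^sup>2 = t ^ (2 * m) * (cmod (?F t))\<^sup>2"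
      by (simp add: norm_mult norm_power power_mult_distrib power_mult[symmetric] mult.commute[of m] power_even_abs)
    finally show "(\<lambda>n. ennreal ((cmod (q n t ^ m * ?F t))\<^sup>2)) \<longlonglongrightarrow> ennreal (t ^ (2 * m) * (cmod (?F t))\<^sup>2)"
      by (rule tendsto_ennrealI)
  qed simp
  also have "\<dots> \<le> liminf (\<lambda>n. \<integral>\<^sup>+t. ennreal ((cmod (q n t ^ m * ?F t))\<^sup>2) \<partial>lborel)"
    by (intro nn_integral_liminf) measurable
  also have "\<dots> \<le> liminf (\<lambda>n. ?C)"
    using le by (intro Liminf_mono always_eventually) auto
  also have "\<dots> = ?C" by (simp add: Liminf_const)
  finally show ?thesis .
qed

section \<open>Square norms tested against continuous functions\<close>

lemma square_le_indicator:
  fixes y K :: real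
  assumes "\<bar>y\<bar> \<le> K * indicator A x"
  shows "y\<^sup>2 \<le> K\<^sup>2 * indicator A x"
  using assms power_mono[of "\<bar>y\<bar>" K 2] by (cases "x \<in> A") auto

text \<open>A converse to $\int b g \le (\|b\|_2^2 + \|g\|_2^2)/2$. If \<open>b\<close> itself could be inserted for \<open>g\<close>, the hypothesis would read
  $\|b\|_2^2 \le C/2 + \|b\|_2^2/2$. Instead \<open>b\<close> is cut off to a bounded function \<open>w k\<close> with bounded
  support; every measurable function is an almost everywhere limit of continuous ones, and after the
  same cutoff dominated convergence carries the hypothesis from these to \<open>w k\<close>. Stating the hypothesis
  with a sum of squares rather than a product of norms spares the use of square roots.\<close>

lemma nn_integral_square_le_if_test:
  fixes b :: "real \<Rightarrow> real"
  assumes [measurable]: "b \<in> borel_measurable borel"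
    and loc: "\<And>k :: nat. set_integrable lborel {- real k..real k} b"
    and C: "C \<ge> 0"
    and test: "\<And>g (B :: real) k. \<lbrakk>\<And>x. isCont g x; \<And>x. \<bar>g x\<bar> \<le> B; \<And>x. \<bar>x\<bar> > k \<Longrightarrow> g x = 0\<rbrakk> \<Longrightarrow>
      (\<integral>x. b x * g x \<partial>lborel) \<le> C / 2 + (\<integral>x. (g x)\<^sup>2 \<partial>lborel) / 2"
  shows "(\<integral>\<^sup>+x. ennreal ((b x)\<^sup>2) \<partial>lborel) \<le> ennreal C"
proof -
  define clip where "clip k y = max (- real k) (min (real k) y)" for k :: nat and y :: real
  \<comment> \<open>a continuous cutoff, equal to 1 where w k may be nonzero\<close>
  define tent where "tent k x = max 0 (min 1 (real k + 1 - \<bar>x\<bar>))" for k :: nat and x :: real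
  define w where "w k x = indicator {- real k..real k} x * clip k (b x)" for k x
  have [measurable]: "w k \<in> borel_measurable borel" for k
    unfolding w_def clip_def by measurable
  have w_le: "\<bar>w k x\<bar> \<le> real k * indicator {- real k..real k} x" for k x
    unfolding w_def clip_def by (auto split: split_indicator)
  have int_Icc: "integrable lborel (indicator {- real k..real k} :: real \<Rightarrow> real)" for k :: nat
    by (intro integrable_real_indicator) (simp_all add: emeasure_lborel_Icc_eq)
  \<comment> \<open>finiteness allows the term on the right of the tested inequality to be absorbed into the left\<close>
  have w2: "integrable lborel (\<lambda>x. (w k x)\<^sup>2)" for k
  proof (rule Bochner_Integration.integrable_bound)
    show "integrable lborel (\<lambda>x. (real k)\<^sup>2 * indicator {- real k..real k} x :: real)"
      using int_Icc by simp
    show "AE x in lborel. norm ((w k x)\<^sup>2) \<le> norm ((real k)\<^sup>2 * indicator {- real k..real k} x :: real)"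
      using square_le_indicator[OF w_le] by (intro AE_I2) simp
  qed measurable
  have bound: "(\<integral>x. (w k x)\<^sup>2 \<partial>lborel) \<le> C" for k
  proof -
    have "w k \<in> borel_measurable lebesgue"
      by (rule measurable_completion) measurable
    then have "w k measurable_on UNIV"
      by (rule lebesgue_measurable_imp_measurable_on_real) simp
    then obtain N g where N: "negligible N" and cont: "\<And>n :: nat. continuous_on UNIV (g n)"
      and lim: "\<And>x. x \<notin> N \<Longrightarrow> (\<lambda>n. g n x) \<longlonglongrightarrow> w k x"
      unfolding measurable_on_def by auto
    define h where "h n x = tent k x * clip k (g n x)" for n x
    have h_cont: "isCont (h n) x" for n x
    proof -
      have "continuous_on UNIV (h n)"
        unfolding h_def tent_def clip_def by (intro continuous_intros cont)
      then show ?thesis by (simp add: continuous_on_eq_continuous_at)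
    qed
    then have [measurable]: "h n \<in> borel_measurable borel" for n
      by (intro borel_measurable_continuous_onI) (simp add: continuous_at_imp_continuous_on)
    have h_le: "\<bar>h n x\<bar> \<le> real k * indicator {- real (Suc k)..real (Suc k)} x" for n x
    proof (cases "x \<in> {- real (Suc k)..real (Suc k)}")
      case True
      have "\<bar>tent k x\<bar> * \<bar>clip k (g n x)\<bar> \<le> 1 * real k"
        by (intro mult_mono) (auto simp: tent_def clip_def)
      then show ?thesis using True by (simp add: h_def abs_mult)
    qed (auto simp: h_def tent_def)
    have h_lim: "AE x in lborel. (\<lambda>n. h n x) \<longlonglongrightarrow> w k x"
    proof -
      have "AE x in lebesgue. x \<notin> N"
        using N by (simp add: negligible_iff_null_sets AE_not_in)
      then have "AE x in lborel. x \<notin> N"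
        by (simp add: AE_completion_iff)
      then show ?thesis
      proof eventually_elim
        case (elim x)
        have "(\<lambda>n. h n x) \<longlonglongrightarrow> tent k x * clip k (w k x)"
          unfolding h_def clip_def by (intro tendsto_intros lim elim)
        also have "tent k x * clip k (w k x) = w k x"
          unfolding tent_def clip_def w_def by (auto split: split_indicator)
        finally show ?case .
      qed
    qed
    have "(\<lambda>n. \<integral>x. b x * h n x \<partial>lborel) \<longlonglongrightarrow> (\<integral>x. b x * w k x \<partial>lborel)"
    proof (rule integral_dominated_convergence)
      show "integrable lborel (\<lambda>x. real k * \<bar>indicator {- real (Suc k)..real (Suc k)} x * b x\<bar>)"
        using loc[of "Suc k"] unfolding set_integrable_def by (auto intro!: integrable_abs)
      show "AE x in lborel. (\<lambda>n. b x * h n x) \<longlonglongrightarrow> b x * w k x"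
        using h_lim by eventually_elim (intro tendsto_intros)
      show "AE x in lborel. norm (b x * h n x) \<le> real k * \<bar>indicator {- real (Suc k)..real (Suc k)} x * b x\<bar>" for n
      proof (intro AE_I2)
        fix x
        show "norm (b x * h n x) \<le> real k * \<bar>indicator {- real (Suc k)..real (Suc k)} x * b x\<bar>"
          using mult_left_mono[OF h_le[of n x], of "\<bar>b x\<bar>"] by (simp add: abs_mult mult_ac)
      qed
    qed measurable
    moreover have "(\<lambda>n. C / 2 + (\<integral>x. (h n x)\<^sup>2 \<partial>lborel) / 2) \<longlonglongrightarrow> C / 2 + (\<integral>x. (w k x)\<^sup>2 \<partial>lborel) / 2"
    proof (intro tendsto_intros integral_dominated_convergence)
      show "integrable lborel (\<lambda>x. (real k)\<^sup>2 * indicator {- real (Suc k)..real (Suc k)} x :: real)"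
        using int_Icc[of "Suc k"] by simp
      show "AE x in lborel. (\<lambda>n. (h n x)\<^sup>2) \<longlonglongrightarrow> (w k x)\<^sup>2"
        using h_lim by eventually_elim (intro tendsto_intros)
      show "AE x in lborel. norm ((h n x)\<^sup>2) \<le> (real k)\<^sup>2 * indicator {- real (Suc k)..real (Suc k)} x" for n
        using square_le_indicator[OF h_le] by (intro AE_I2) simp
    qed auto
    moreover have "(\<integral>x. b x * h n x \<partial>lborel) \<le> C / 2 + (\<integral>x. (h n x)\<^sup>2 \<partial>lborel) / 2" for n
    proof (rule test[of "h n" "real k" "real (Suc k)"])
      show "\<bar>h n x\<bar> \<le> real k" for x
        using h_le[of n x] by (auto split: split_indicator_asm)
      show "h n x = 0" if "\<bar>x\<bar> > real (Suc k)" for x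
        using that by (simp add: h_def tent_def)
    qed (rule h_cont)
    ultimately have "(\<integral>x. b x * w k x \<partial>lborel) \<le> C / 2 + (\<integral>x. (w k x)\<^sup>2 \<partial>lborel) / 2"
      by (intro LIMSEQ_le) auto
    moreover have "(\<integral>x. (w k x)\<^sup>2 \<partial>lborel) \<le> (\<integral>x. b x * w k x \<partial>lborel)"
    proof (rule integral_mono[OF w2])
      show "integrable lborel (\<lambda>x. b x * w k x)"
      proof (rule Bochner_Integration.integrable_bound)
        show "integrable lborel (\<lambda>x. real k * (indicator {- real k..real k} x * b x))"
          using loc[of k] unfolding set_integrable_def by auto
        show "AE x in lborel. norm (b x * w k x) \<le> norm (real k * (indicator {- real k..real k} x * b x))"
        proof (intro AE_I2)
          fix x
          show "norm (b x * w k x) \<le> norm (real k * (indicator {- real k..real k} x * b x))"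
            using mult_left_mono[OF w_le[of k x], of "\<bar>b x\<bar>"] by (simp add: abs_mult mult_ac)
        qed
      qed measurable
      show "(w k x)\<^sup>2 \<le> b x * w k x" for x
      proof (cases "x \<in> {- real k..real k}")
        case True
        have "clip k y * clip k y \<le> y * clip k y" for y
        proof (cases "y \<ge> 0")
          case True
          then show ?thesis by (intro mult_right_mono) (auto simp: clip_def)
        next
          case False
          then show ?thesis by (intro mult_right_mono_neg) (auto simp: clip_def)
        qed
        with True show ?thesis by (simp add: w_def power2_eq_square)
      qed (auto simp: w_def)
    qed
    ultimately show ?thesis by simp
  qed
  have "(\<integral>\<^sup>+x. ennreal ((b x)\<^sup>2) \<partial>lborel) = (\<integral>\<^sup>+x. liminf (\<lambda>k. ennreal ((w k x)\<^sup>2)) \<partial>lborel)"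
  proof (intro nn_integral_cong lim_imp_Liminf[symmetric])
    fix x
    obtain K :: nat where K: "max \<bar>x\<bar> \<bar>b x\<bar> \<le> real K" using real_arch_simple by blast
    have "\<forall>\<^sub>F k in sequentially. ennreal ((b x)\<^sup>2) = ennreal ((w k x)\<^sup>2)"
      using eventually_ge_at_top[of K]
    proof eventually_elim
      case (elim k)
      then have "real K \<le> real k" by simp
      with K have "\<bar>x\<bar> \<le> real k" "\<bar>b x\<bar> \<le> real k" by linarith+
      then have "w k x = b x" by (auto simp: w_def clip_def abs_le_iff)
      then show ?case by simp
    qed
    then show "(\<lambda>k. ennreal ((w k x)\<^sup>2)) \<longlonglongrightarrow> ennreal ((b x)\<^sup>2)"
      by (rule tendsto_eventually[OF eventually_mono]) simp
  qed simp
  also have "\<dots> \<le> liminf (\<lambda>k. \<integral>\<^sup>+x. ennreal ((w k x)\<^sup>2) \<partial>lborel)"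
    by (intro nn_integral_liminf) measurable
  also have "\<dots> \<le> liminf (\<lambda>k. ennreal C)"
    using bound w2 by (intro Liminf_mono always_eventually) (auto simp: nn_integral_eq_integral intro: ennreal_leI)
  also have "\<dots> = ennreal C" by (simp add: Liminf_const)
  finally show ?thesis .
qed

section \<open>The sinc kernel and its bias\<close>

definition sinc_kernel :: "real \<Rightarrow> real \<Rightarrow> real" where
  "sinc_kernel h y = (if y = 0 then 1 / h else sin (y / h) / y) / pi"

lemma borel_measurable_sinc_kernel [measurable]: "sinc_kernel h \<in> borel_measurable borel"
  unfolding sinc_kernel_def[abs_def] by measurable

abbreviation band :: "real \<Rightarrow> real \<Rightarrow> complex" where
  "band h \<equiv> indicator {- (1 / h)..1 / h}"

lemma integrable_band: "integrable lborel (band h)"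
proof -
  have "integrable lborel (\<lambda>t. complex_of_real (indicator {- (1 / h)..1 / h} t))"
    by (intro integrable_of_real integrable_real_indicator) (simp_all add: emeasure_lborel_Icc_eq)
  then show ?thesis by (simp add: of_real_indicator)
qed

lemma iexp_diff: "iexp \<theta> - iexp (- \<theta>) = 2 * \<i> * of_real (sin \<theta>)"
  unfolding cis_conv_exp[symmetric] by (simp add: complex_eq_iff)

text \<open>The sinc kernel is the inverse transform of the indicator of the frequencies \<open>\<bar>t\<bar> \<le> 1 / h\<close>. The value
  \<open>1 / h\<close> taken at \<open>0\<close> in place of the quotient is what makes this true at every \<open>y\<close>.\<close>

lemma fourier_band:
  assumes h: "h > 0"
  shows "fourier (band h) y = of_real (2 * pi * sinc_kernel h y)"
proof -
  define a where "a = 1 / h"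
  have a: "a > 0" using h by (simp add: a_def)
  have "((\<lambda>t. iexp (t * y)) has_integral of_real (2 * pi * sinc_kernel h y)) {- a..a}"
  proof (cases "y = 0")
    case True
    then show ?thesis
      using has_integral_const_real[of "1 :: complex" "- a" a] a h
      by (simp add: sinc_kernel_def a_def scaleR_conv_of_real)
  next
    case False
    define G where "G t = iexp (t * y) / (\<i> * y)" for t :: real
    have "((\<lambda>t. iexp (t * y)) has_integral (G a - G (- a))) {- a..a}"
    proof (rule fundamental_theorem_of_calculus)
      fix t
      have "((\<lambda>z. exp (\<i> * (z * y)) / (\<i> * y)) has_field_derivative exp (\<i> * (t * y)) * (\<i> * y) / (\<i> * y)) (at (of_real t))"
        by (rule DERIV_cdivide) (auto intro!: derivative_eq_intros)
      from has_vector_derivative_real_field[OF this]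
      show "(G has_vector_derivative iexp (t * y)) (at t within {- a..a})"
        using False unfolding G_def by (simp add: has_vector_derivative_at_within)
    qed (use a in simp)
    also have "G a - G (- a) = of_real (2 * pi * sinc_kernel h y)"
    proof -
      have "iexp (a * y) - iexp (- a * y) = 2 * \<i> * of_real (sin (y / h))"
        using iexp_diff[of "y / h"] by (simp add: a_def)
      then show ?thesis
        using False unfolding G_def sinc_kernel_def diff_divide_distrib[symmetric] by simp
    qed
    finally show ?thesis .
  qed
  moreover have "set_integrable lborel {- a..a} (\<lambda>t. iexp (t * y))"
    by (intro borel_integrable_compact[unfolded set_integrable_def[symmetric]] continuous_intros) auto
  ultimately have "(LINT t:{- a..a}|lborel. iexp (t * y)) = of_real (2 * pi * sinc_kernel h y)"
    using set_borel_integral_eq_integral(2) integral_unique by metis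
  then show ?thesis
    unfolding fourier_def set_lebesgue_integral_def a_def
    by (simp add: scaleR_conv_of_real mult.commute of_real_indicator)
qed

lemma sinc_kernel_minus: "sinc_kernel h (- y) = sinc_kernel h y"
  by (simp add: sinc_kernel_def)

lemma abs_sinc_kernel_le:
  assumes "h > 0"
  shows "\<bar>sinc_kernel h y\<bar> \<le> 1 / (pi * h)"
proof (cases "y = 0")
  case False
  have "\<bar>sin (y / h)\<bar> \<le> \<bar>y / h\<bar>" by (rule abs_sin_x_le_abs_x)
  then have "\<bar>sin (y / h)\<bar> / \<bar>y\<bar> \<le> (\<bar>y\<bar> / h) / \<bar>y\<bar>"
    using assms by (intro divide_right_mono) auto
  then have "\<bar>sin (y / h)\<bar> / \<bar>y\<bar> / pi \<le> 1 / h / pi"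
    using False by (intro divide_right_mono) auto
  then show ?thesis using False by (simp add: sinc_kernel_def abs_divide abs_mult mult.commute)
qed (use assms in \<open>simp add: sinc_kernel_def abs_divide mult.commute\<close>)

text \<open>Plancherel's inequality for the indicator of the band, whose length is \<open>2 / h\<close>.\<close>

lemma nn_integral_sinc_kernel_square_le:
  assumes h: "h > 0"
  shows "(\<integral>\<^sup>+y. ennreal ((sinc_kernel h y)\<^sup>2) \<partial>lborel) \<le> ennreal (1 / (pi * h))"
proof -
  have "ennreal ((2 * pi)\<^sup>2) * (\<integral>\<^sup>+y. ennreal ((sinc_kernel h y)\<^sup>2) \<partial>lborel)
      = (\<integral>\<^sup>+y. ennreal ((cmod (fourier (band h) y))\<^sup>2) \<partial>lborel)"
    unfolding fourier_band[OF h]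
    by (subst nn_integral_cmult[symmetric]) (auto simp: power_mult_distrib norm_mult ennreal_mult[symmetric])
  also have "\<dots> \<le> ennreal (2 * pi) * (\<integral>\<^sup>+t. ennreal ((cmod (band h t))\<^sup>2) \<partial>lborel)"
    by (rule plancherel_le[OF integrable_band])
  also have "(\<integral>\<^sup>+t. ennreal ((cmod (band h t))\<^sup>2) \<partial>lborel) = (\<integral>\<^sup>+t. indicator {- (1 / h)..1 / h} t \<partial>lborel)"
    by (intro nn_integral_cong) (auto split: split_indicator)
  also have "\<dots> = ennreal (2 / h)" using h by simp
  finally have "ennreal ((2 * pi)\<^sup>2) * (\<integral>\<^sup>+y. ennreal ((sinc_kernel h y)\<^sup>2) \<partial>lborel) \<le> ennreal (2 * pi) * ennreal (2 / h)" .
  then have "ennreal (1 / (2 * pi)\<^sup>2) * (ennreal ((2 * pi)\<^sup>2) * (\<integral>\<^sup>+y. ennreal ((sinc_kernel h y)\<^sup>2) \<partial>lborel))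
      \<le> ennreal (1 / (2 * pi)\<^sup>2) * (ennreal (2 * pi) * ennreal (2 / h))"
    by (rule mult_left_mono) simp
  moreover have "ennreal (1 / (2 * pi)\<^sup>2) * (ennreal (2 * pi) * ennreal (2 / h)) = ennreal (1 / (pi * h))"
    using h by (simp add: ennreal_mult[symmetric] power2_eq_square field_simps)
  moreover have "ennreal (1 / (2 * pi)\<^sup>2) * (ennreal ((2 * pi)\<^sup>2) * E) = E" for E
    by (simp add: mult.assoc[symmetric] ennreal_mult[symmetric])
  ultimately show ?thesis by simp
qed

definition sinc_smooth :: "real \<Rightarrow> (real \<Rightarrow> real) \<Rightarrow> real \<Rightarrow> real" where
  "sinc_smooth h f x = (\<integral>y. sinc_kernel h (x - y) * f y \<partial>lborel)"

lemma borel_measurable_sinc_smooth: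
  assumes [measurable]: "f \<in> borel_measurable borel"
  shows "sinc_smooth h f \<in> borel_measurable borel"
  unfolding sinc_smooth_def[abs_def] by measurable

lemma integrable_sinc_kernel_mult:
  assumes h: "h > 0" and f: "integrable lborel f"
  shows "integrable lborel (\<lambda>y. sinc_kernel h (x - y) * f y)"
proof (rule Bochner_Integration.integrable_bound)
  have [measurable]: "f \<in> borel_measurable borel" using f by auto
  show "integrable lborel (\<lambda>y. 1 / (pi * h) * f y)" using f by simp
  show "AE y in lborel. norm (sinc_kernel h (x - y) * f y) \<le> norm (1 / (pi * h) * f y)"
    unfolding norm_mult using abs_sinc_kernel_le[OF h] h
    by (intro AE_I2 mult_right_mono) simp_all
  show "(\<lambda>y. sinc_kernel h (x - y) * f y) \<in> borel_measurable lborel" by measurable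
qed

lemma abs_sinc_smooth_le:
  assumes h: "h > 0" and f: "integrable lborel f"
  shows "\<bar>sinc_smooth h f x\<bar> \<le> 1 / (pi * h) * (\<integral>y. \<bar>f y\<bar> \<partial>lborel)"
proof -
  have "\<bar>sinc_smooth h f x\<bar> \<le> (\<integral>y. \<bar>sinc_kernel h (x - y) * f y\<bar> \<partial>lborel)"
    unfolding sinc_smooth_def using integral_norm_bound[of lborel "\<lambda>y. sinc_kernel h (x - y) * f y"] by simp
  also have "\<dots> \<le> (\<integral>y. 1 / (pi * h) * \<bar>f y\<bar> \<partial>lborel)"
    using integrable_sinc_kernel_mult[OF h f] f abs_sinc_kernel_le[OF h]
    by (intro integral_mono integrable_abs integrable_mult_right) (auto simp only: abs_mult intro!: mult_right_mono)
  finally show ?thesis by simp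
qed

lemma integrable_band_mult_fourier:
  assumes "integrable lborel u"
  shows "integrable lborel (\<lambda>t. band h t * cnj (fourier u t))"
proof -
  have "integrable lborel (\<lambda>t. cnj (fourier u t * band h t))"
    by (intro integrable_cnj integrable_fourier_mult assms integrable_band)
  moreover have "cnj (band h t) = band h t" for t
    by (simp split: split_indicator)
  ultimately show ?thesis by (simp add: mult.commute)
qed

text \<open>Convolution with the sinc kernel truncates the characteristic function of \<open>f\<close> to the band. The
  conjugate appears because the inverse transform of a function is, up to $2\pi$, the conjugate of the
  transform of its conjugate, and \<open>sinc_smooth h f\<close> is real.\<close>

lemma sinc_smooth_conv_fourier:
  assumes h: "h > 0" and f: "integrable lborel f"
  shows "of_real (2 * pi * sinc_smooth h f x) = fourier (\<lambda>t. band h t * cnj (fourier (\<lambda>x. of_real (f x)) t)) x"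
proof -
  let ?f = "\<lambda>x. complex_of_real (f x)"
  have f': "integrable lborel ?f" using f by simp
  have shift: "fourier (\<lambda>t. iexp (- x * t) * band h t) y = fourier (band h) (y - x)" for y
  proof -
    have "iexp (t * y) * iexp (- x * t) = iexp (t * (y - x))" for t
      unfolding exp_add[symmetric] by (rule arg_cong[where f=exp]) (simp add: algebra_simps)
    then show ?thesis unfolding fourier_def mult.assoc[symmetric] by simp
  qed
  have "(CLINT t|lborel. fourier ?f t * (iexp (- x * t) * band h t))
      = (CLINT y|lborel. ?f y * fourier (\<lambda>t. iexp (- x * t) * band h t) y)"
    by (intro fourier_multiplication_formula f' integrable_iexp_mult integrable_band)
  also have "\<dots> = (CLINT y|lborel. of_real (2 * pi * (sinc_kernel h (x - y) * f y)))"
    unfolding shift fourier_band[OF h]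
    using sinc_kernel_minus[of h "x - y" for y] by (intro Bochner_Integration.integral_cong refl) simp
  also have "\<dots> = of_real (2 * pi * sinc_smooth h f x)"
    unfolding sinc_smooth_def integral_complex_of_real by simp
  finally have "of_real (2 * pi * sinc_smooth h f x) = cnj (CLINT t|lborel. fourier ?f t * (iexp (- x * t) * band h t))"
    by (metis complex_cnj_complex_of_real)
  also have "\<dots> = (CLINT t|lborel. cnj (fourier ?f t * (iexp (- x * t) * band h t)))"
    by (rule Bochner_Integration.integral_cnj[symmetric])
  also have "\<dots> = fourier (\<lambda>t. band h t * cnj (fourier ?f t)) x"
    unfolding fourier_def[of "\<lambda>t. band h t * cnj (fourier ?f t)"]
    by (intro Bochner_Integration.integral_cong refl) (simp add: exp_cnj mult_ac split: split_indicator)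
  finally show ?thesis .
qed

lemma integral_sinc_smooth_mult:
  assumes h: "h > 0" and f: "integrable lborel f" and g: "integrable lborel g"
  shows "of_real (2 * pi * (\<integral>x. sinc_smooth h f x * g x \<partial>lborel))
    = (CLINT t|lborel. band h t * cnj (fourier (\<lambda>x. of_real (f x)) t) * fourier (\<lambda>x. of_real (g x)) t)"
proof -
  let ?F = "fourier (\<lambda>x. complex_of_real (f x))"
  have "of_real (2 * pi * (\<integral>x. sinc_smooth h f x * g x \<partial>lborel))
      = (CLINT x|lborel. of_real (2 * pi * sinc_smooth h f x) * of_real (g x))"
    by (simp add: mult.assoc flip: of_real_mult)
  also have "\<dots> = (CLINT x|lborel. fourier (\<lambda>t. band h t * cnj (?F t)) x * of_real (g x))"
    unfolding sinc_smooth_conv_fourier[OF h f] ..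
  also have "\<dots> = (CLINT t|lborel. band h t * cnj (?F t) * fourier (\<lambda>x. of_real (g x)) t)"
    by (intro fourier_multiplication_formula integrable_band_mult_fourier integrable_of_real f g)
  finally show ?thesis .
qed

text \<open>On the Fourier side \<open>f - sinc_smooth h f\<close> is what remains of the transform of \<open>f\<close> outside the band, but
  \<open>f\<close> need not be recoverable from its transform by a convergent integral. So the difference is paired with
  a continuous test function \<open>g\<close>: Parseval's formula turns the pairing into
  $\frac{1}{2\pi}\int_{|t| > 1/h} \overline{\hat f}\,\hat g$, which is at most $\frac{1}{4\pi}$ times the tail plus
  $\frac12\|g\|_2^2$ by Plancherel's inequality for \<open>g\<close>. This is the hypothesis of \<open>nn_integral_square_le_if_test\<close>.\<close>

theorem sinc_bias_le:
  assumes h: "h > 0" and f: "integrable lborel f"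
  shows "(\<integral>\<^sup>+x. ennreal ((sinc_smooth h f x - f x)\<^sup>2) \<partial>lborel)
    \<le> ennreal (1 / (2 * pi)) * (\<integral>\<^sup>+t. ennreal ((cmod (fourier (\<lambda>x. of_real (f x)) t))\<^sup>2) * indicator (- {- (1 / h)..1 / h}) t \<partial>lborel)"
    (is "_ \<le> _ * ?T")
proof (cases "?T = \<infinity>")
  case True
  then show ?thesis by (simp add: ennreal_mult_top)
next
  case False
  let ?f = "\<lambda>x. complex_of_real (f x)"
  let ?F = "fourier ?f"
  have f': "integrable lborel ?f" using f by simp
  have [measurable]: "f \<in> borel_measurable borel" using f by auto
  note [measurable] = borel_measurable_sinc_smooth[of f h] borel_measurable_fourier[OF f']
  define T where "T = enn2real ?T"
  have T: "?T = ennreal T" "T \<ge> 0" using False by (auto simp: T_def less_top)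
  define B where "B = (\<integral>x. cmod (?f x) \<partial>lborel)"
  have "(\<integral>\<^sup>+t. ennreal ((cmod (?F t))\<^sup>2) \<partial>lborel)
      \<le> (\<integral>\<^sup>+t. ennreal (B\<^sup>2) * indicator {- (1 / h)..1 / h} t
          + ennreal ((cmod (?F t))\<^sup>2) * indicator (- {- (1 / h)..1 / h}) t \<partial>lborel)"
    using norm_fourier_le[OF f'] unfolding B_def[symmetric]
    by (intro nn_integral_mono) (auto split: split_indicator intro!: ennreal_leI power_mono)
  also have "\<dots> = ennreal (B\<^sup>2) * ennreal (2 / h) + ?T"
    using h by (subst nn_integral_add) (auto simp: nn_integral_cmult)
  also have "\<dots> < \<infinity>" unfolding T(1) by (simp add: ennreal_mult_less_top)
  finally have F2: "integrable lborel (\<lambda>t. (cmod (?F t))\<^sup>2)"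
    by (intro integrableI_bounded) auto
  have "(\<integral>\<^sup>+x. ennreal ((f x - sinc_smooth h f x)\<^sup>2) \<partial>lborel) \<le> ennreal (T / (2 * pi))"
  proof (rule nn_integral_square_le_if_test)
    show "(\<lambda>x. f x - sinc_smooth h f x) \<in> borel_measurable borel" by measurable
    show "T / (2 * pi) \<ge> 0" using T by simp
    show "set_integrable lborel {- real k..real k} (\<lambda>x. f x - sinc_smooth h f x)" for k
    proof (rule set_integral_diff(1))
      show "set_integrable lborel {- real k..real k} f"
        unfolding set_integrable_def using f by (intro integrable_mult_indicator) auto
      define B' where "B' = 1 / (pi * h) * (\<integral>y. \<bar>f y\<bar> \<partial>lborel)"
      show "set_integrable lborel {- real k..real k} (sinc_smooth h f)"
        unfolding set_integrable_def
      proof (rule Bochner_Integration.integrable_bound)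
        show "integrable lborel (\<lambda>x. indicator {- real k..real k} x *\<^sub>R B')"
          by (intro integrable_scaleR_left integrable_real_indicator) (simp_all add: emeasure_lborel_Icc_eq)
        show "AE x in lborel. norm (indicator {- real k..real k} x *\<^sub>R sinc_smooth h f x)
            \<le> norm (indicator {- real k..real k} x *\<^sub>R B')"
          using order_trans[OF abs_sinc_smooth_le[OF h f] abs_ge_self] unfolding B'_def
          by (intro AE_I2) (auto split: split_indicator)
      qed measurable
    qed
    fix g :: "real \<Rightarrow> real" and D k :: real
    assume g: "\<And>x. isCont g x" "\<And>x. \<bar>g x\<bar> \<le> D" "\<And>x. \<bar>x\<bar> > k \<Longrightarrow> g x = 0"
    let ?g = "\<lambda>x. complex_of_real (g x)"
    let ?G = "fourier ?g"
    have [measurable]: "g \<in> borel_measurable borel"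
      using g(1) by (intro borel_measurable_continuous_onI) (simp add: continuous_at_imp_continuous_on)
    have g_le: "\<bar>g x\<bar> \<le> D * indicator {- k..k} x" for x
      using g(2)[of x] g(3)[of x] by (auto split: split_indicator)
    have int_Icc: "integrable lborel (\<lambda>x. c * indicator {- k..k} x :: real)" for c
      by (intro integrable_mult_right integrable_real_indicator) (simp_all add: emeasure_lborel_Icc_eq)
    have g_int: "integrable lborel g"
      by (rule Bochner_Integration.integrable_bound[OF int_Icc[of D]])
         (auto intro!: AE_I2 order_trans[OF g_le abs_ge_self])
    then have g_int': "integrable lborel ?g" by simp
    note [measurable] = borel_measurable_fourier[OF g_int']
    have g2: "integrable lborel (\<lambda>x. (g x)\<^sup>2)"
      by (rule Bochner_Integration.integrable_bound[OF int_Icc[of "D\<^sup>2"]])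
         (use square_le_indicator[OF g_le] in auto)
    have G_le: "(\<integral>\<^sup>+t. ennreal ((cmod (?G t))\<^sup>2) \<partial>lborel) \<le> ennreal (2 * pi * (\<integral>x. (g x)\<^sup>2 \<partial>lborel))"
    proof -
      have "(\<integral>\<^sup>+t. ennreal ((cmod (?G t))\<^sup>2) \<partial>lborel) \<le> ennreal (2 * pi) * (\<integral>\<^sup>+x. ennreal ((g x)\<^sup>2) \<partial>lborel)"
        using plancherel_le[OF g_int'] by simp
      also have "\<dots> = ennreal (2 * pi * (\<integral>x. (g x)\<^sup>2 \<partial>lborel))"
        using g2 by (subst nn_integral_eq_integral) (auto simp: ennreal_mult')
      finally show ?thesis .
    qed
    then have G2: "integrable lborel (\<lambda>t. (cmod (?G t))\<^sup>2)"
      by (intro integrableI_bounded) (auto intro: le_less_trans)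
    have FG: "integrable lborel (\<lambda>t. ?F t * cnj (?G t))"
    proof (rule Bochner_Integration.integrable_bound)
      show "integrable lborel (\<lambda>t. ((cmod (?F t))\<^sup>2 + (cmod (?G t))\<^sup>2) / 2)"
        using F2 G2 by simp
      show "AE t in lborel. norm (?F t * cnj (?G t)) \<le> norm (((cmod (?F t))\<^sup>2 + (cmod (?G t))\<^sup>2) / 2)"
        using sum_squares_bound[of "cmod (?F t)" "cmod (?G t)" for t]
        by (intro AE_I2) (auto simp: norm_mult mult_ac)
    qed measurable
    have FG': "integrable lborel (\<lambda>t. cnj (?F t) * ?G t)"
      using integrable_cnj[OF FG] by simp
    have bFG: "integrable lborel (\<lambda>t. band h t * cnj (?F t) * ?G t)"
      using integrable_fourier_mult[OF g_int' integrable_band_mult_fourier[OF f', of h]] by (simp add: mult.commute)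
    have "(CLINT t|lborel. ?F t * cnj (?G t)) = 2 * pi * (CLINT x|lborel. ?f x * cnj (?g x))"
    proof (rule parseval_continuous[OF f' g_int' _ _ FG])
      show "isCont ?g x" for x using g(1)[of x] by (rule continuous_of_real)
      show "cmod (?g x) \<le> D" for x using g(2) by simp
    qed
    also have "\<dots> = of_real (2 * pi * (\<integral>x. f x * g x \<partial>lborel))"
      by (simp flip: of_real_mult)
    finally have fg: "of_real (2 * pi * (\<integral>x. f x * g x \<partial>lborel)) = (CLINT t|lborel. cnj (?F t) * ?G t)"
      using Bochner_Integration.integral_cnj[of lborel "\<lambda>t. ?F t * cnj (?G t)"] by simp
    have int_fg: "integrable lborel (\<lambda>x. f x * g x)"
    proof (rule Bochner_Integration.integrable_bound)
      show "integrable lborel (\<lambda>x. D * f x)" using f by simp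
      show "AE x in lborel. norm (f x * g x) \<le> norm (D * f x)"
        using order_trans[OF g(2) abs_ge_self]
        by (intro AE_I2) (simp add: abs_mult mult.commute[of D] mult.commute[of "\<bar>D\<bar>"] mult_left_mono)
    qed measurable
    have int_sg: "integrable lborel (\<lambda>x. sinc_smooth h f x * g x)"
    proof (rule Bochner_Integration.integrable_bound)
      define B' where "B' = 1 / (pi * h) * (\<integral>y. \<bar>f y\<bar> \<partial>lborel)"
      show "integrable lborel (\<lambda>x. B' * g x)" using g_int by simp
      show "AE x in lborel. norm (sinc_smooth h f x * g x) \<le> norm (B' * g x)"
        using order_trans[OF abs_sinc_smooth_le[OF h f, folded B'_def] abs_ge_self]
        by (intro AE_I2) (simp add: abs_mult mult_right_mono)
    qed measurable
    have "of_real (2 * pi * (\<integral>x. (f x - sinc_smooth h f x) * g x \<partial>lborel))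
        = of_real (2 * pi * (\<integral>x. f x * g x \<partial>lborel)) - of_real (2 * pi * (\<integral>x. sinc_smooth h f x * g x \<partial>lborel))"
      unfolding left_diff_distrib Bochner_Integration.integral_diff[OF int_fg int_sg] of_real_diff[symmetric] right_diff_distrib ..
    also have "\<dots> = (CLINT t|lborel. cnj (?F t) * ?G t - band h t * cnj (?F t) * ?G t)"
      unfolding fg integral_sinc_smooth_mult[OF h f g_int] by (rule Bochner_Integration.integral_diff[OF FG' bFG, symmetric])
    finally have eq: "complex_of_real (2 * pi * (\<integral>x. (f x - sinc_smooth h f x) * g x \<partial>lborel))
        = (CLINT t|lborel. cnj (?F t) * ?G t - band h t * cnj (?F t) * ?G t)" .
    have "ennreal (2 * pi * (\<integral>x. (f x - sinc_smooth h f x) * g x \<partial>lborel))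
        \<le> ennreal (norm (complex_of_real (2 * pi * (\<integral>x. (f x - sinc_smooth h f x) * g x \<partial>lborel))))"
      unfolding norm_of_real by (intro ennreal_leI abs_ge_self)
    also have "\<dots> \<le> (\<integral>\<^sup>+t. ennreal (norm (cnj (?F t) * ?G t - band h t * cnj (?F t) * ?G t)) \<partial>lborel)"
      unfolding eq by (rule norm_integral_le_nn_integral)
    also have "\<dots> \<le> (\<integral>\<^sup>+t. ennreal (1 / 2) * (ennreal ((cmod (?F t))\<^sup>2) * indicator (- {- (1 / h)..1 / h}) t
        + ennreal ((cmod (?G t))\<^sup>2)) \<partial>lborel)"
    proof (intro nn_integral_mono)
      fix t
      have "cmod (?F t) * cmod (?G t) \<le> 1 / 2 * ((cmod (?F t))\<^sup>2 + (cmod (?G t))\<^sup>2)"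
        using sum_squares_bound[of "cmod (?F t)" "cmod (?G t)"] by simp
      then have "ennreal (cmod (?F t) * cmod (?G t)) \<le> ennreal (1 / 2 * ((cmod (?F t))\<^sup>2 + (cmod (?G t))\<^sup>2))"
        by (rule ennreal_leI)
      also have "\<dots> = ennreal (1 / 2) * (ennreal ((cmod (?F t))\<^sup>2) + ennreal ((cmod (?G t))\<^sup>2))"
        by (subst ennreal_mult, simp, simp, subst ennreal_plus) auto
      finally show "ennreal (norm (cnj (?F t) * ?G t - band h t * cnj (?F t) * ?G t))
          \<le> ennreal (1 / 2) * (ennreal ((cmod (?F t))\<^sup>2) * indicator (- {- (1 / h)..1 / h}) t + ennreal ((cmod (?G t))\<^sup>2))"
        by (cases "t \<in> {- (1 / h)..1 / h}") (simp_all add: norm_mult)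
    qed
    also have "\<dots> = ennreal (1 / 2) * (?T + (\<integral>\<^sup>+t. ennreal ((cmod (?G t))\<^sup>2) \<partial>lborel))"
      by (subst nn_integral_cmult, measurable, subst nn_integral_add) auto
    also have "\<dots> \<le> ennreal (1 / 2) * (ennreal T + ennreal (2 * pi * (\<integral>x. (g x)\<^sup>2 \<partial>lborel)))"
      unfolding T(1) by (intro mult_left_mono add_left_mono G_le) simp
    also have "\<dots> = ennreal (1 / 2 * (T + 2 * pi * (\<integral>x. (g x)\<^sup>2 \<partial>lborel)))"
      by (subst ennreal_mult, simp, use T(2) in simp, subst ennreal_plus) (use T(2) in auto)
    finally have "2 * pi * (\<integral>x. (f x - sinc_smooth h f x) * g x \<partial>lborel) \<le> 1 / 2 * (T + 2 * pi * (\<integral>x. (g x)\<^sup>2 \<partial>lborel))"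
      using T(2) by (subst (asm) ennreal_le_iff) auto
    then show "(\<integral>x. (f x - sinc_smooth h f x) * g x \<partial>lborel) \<le> T / (2 * pi) / 2 + (\<integral>x. (g x)\<^sup>2 \<partial>lborel) / 2"
      by (simp add: field_simps)
  qed
  also have "\<dots> = ennreal (1 / (2 * pi)) * ?T"
    unfolding T(1) using T(2) by (simp add: ennreal_mult[symmetric])
  finally show ?thesis by (simp add: power2_commute[of "f _"])
qed

section \<open>The mean integrated squared error\<close>

text \<open>In the expansion of the squared sum, independence gives $\mu^2$ off the diagonal, so only the \<open>n\<close> diagonal
  terms contribute $A - \mu^2$; division by $n^2$ leaves the factor \<open>1 / n\<close>.\<close>

lemma (in prob_space) sample_mean_square_error:
  fixes Y :: "nat \<Rightarrow> 'a \<Rightarrow> real"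
  assumes indep: "indep_vars (\<lambda>_. borel) Y {1..n}" and n: "n \<ge> 1"
    and bounded: "\<And>j \<omega>. \<bar>Y j \<omega>\<bar> \<le> B"
    and mean: "\<And>j. j \<in> {1..n} \<Longrightarrow> expectation (Y j) = \<mu>"
    and square: "\<And>j. j \<in> {1..n} \<Longrightarrow> expectation (\<lambda>\<omega>. (Y j \<omega>)\<^sup>2) = A"
  shows "integrable M (\<lambda>\<omega>. ((\<Sum>j=1..n. Y j \<omega>) / n - c)\<^sup>2)" (is ?int)
    and "expectation (\<lambda>\<omega>. ((\<Sum>j=1..n. Y j \<omega>) / n - c)\<^sup>2) = (A - \<mu>\<^sup>2) / n + (\<mu> - c)\<^sup>2" (is ?eq)
proof -
  have meas: "Y j \<in> borel_measurable M" if "j \<in> {1..n}" for j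
    using indep that by (auto simp: indep_vars_def)
  have int: "integrable M (Y j)" if "j \<in> {1..n}" for j
    by (rule integrable_const_bound[where B=B]) (use meas that bounded in auto)
  have int2: "integrable M (\<lambda>\<omega>. Y i \<omega> * Y j \<omega>)" if "i \<in> {1..n}" "j \<in> {1..n}" for i j
  proof (rule integrable_const_bound[where B="B * B"])
    have "0 \<le> B" using bounded[of i undefined] by linarith
    then show "AE \<omega> in M. norm (Y i \<omega> * Y j \<omega>) \<le> B * B"
      using bounded by (intro AE_I2) (auto simp: abs_mult intro!: mult_mono)
  qed (use meas that in auto)
  have prod: "expectation (\<lambda>\<omega>. Y i \<omega> * Y j \<omega>) = (if i = j then A else \<mu>\<^sup>2)"
    if "i \<in> {1..n}" "j \<in> {1..n}" for i j
  proof (cases "i = j")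
    case True
    then show ?thesis using square[OF that(1)] by (simp add: power2_eq_square)
  next
    case False
    have "expectation (\<lambda>\<omega>. \<Prod>k\<in>{i, j}. Y k \<omega>) = (\<Prod>k\<in>{i, j}. expectation (Y k))"
      using that int by (intro indep_vars_lebesgue_integral indep_vars_subset[OF indep]) auto
    then show ?thesis using False mean that by (simp add: power2_eq_square)
  qed
  define S where "S \<omega> = (\<Sum>j=1..n. Y j \<omega>)" for \<omega>
  have S: "integrable M S" unfolding S_def using int by auto
  have ES: "expectation S = n * \<mu>"
    unfolding S_def using int mean by (simp add: Bochner_Integration.integral_sum)
  have SS: "(S \<omega>)\<^sup>2 = (\<Sum>i=1..n. \<Sum>j=1..n. Y i \<omega> * Y j \<omega>)" for \<omega>
    unfolding S_def power2_eq_square by (rule sum_product)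
  have S2: "integrable M (\<lambda>\<omega>. (S \<omega>)\<^sup>2)"
    unfolding SS using int2 by (intro Bochner_Integration.integrable_sum) auto
  have "expectation (\<lambda>\<omega>. (S \<omega>)\<^sup>2) = (\<Sum>i=1..n. expectation (\<lambda>\<omega>. \<Sum>j=1..n. Y i \<omega> * Y j \<omega>))"
    unfolding SS by (rule Bochner_Integration.integral_sum) (use int2 in auto)
  also have "\<dots> = (\<Sum>i=1..n. \<Sum>j=1..n. expectation (\<lambda>\<omega>. Y i \<omega> * Y j \<omega>))"
    by (intro sum.cong refl Bochner_Integration.integral_sum int2)
  also have "\<dots> = (\<Sum>i=1..n. \<Sum>j=1..n. \<mu>\<^sup>2 + (if i = j then A - \<mu>\<^sup>2 else 0))"
    by (intro sum.cong refl) (simp add: prod)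
  also have "\<dots> = n * (n * \<mu>\<^sup>2 + (A - \<mu>\<^sup>2))"
    by (simp add: sum.distrib distrib_left)
  finally have ES2: "expectation (\<lambda>\<omega>. (S \<omega>)\<^sup>2) = n * (n * \<mu>\<^sup>2 + (A - \<mu>\<^sup>2))" .
  have expand: "(S \<omega> / n - c)\<^sup>2 = (S \<omega>)\<^sup>2 / (real n)\<^sup>2 - 2 * c / n * S \<omega> + c\<^sup>2" for \<omega>
    using n by (simp add: power2_eq_square field_simps)
  have "integrable M (\<lambda>\<omega>. (S \<omega> / n - c)\<^sup>2)"
    unfolding expand using S S2 by simp
  then show ?int unfolding S_def .
  have "expectation (\<lambda>\<omega>. (S \<omega> / n - c)\<^sup>2) = expectation (\<lambda>\<omega>. (S \<omega>)\<^sup>2) / (real n)\<^sup>2 - 2 * c / n * expectation S + c\<^sup>2"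
    unfolding expand using S S2 by (simp add: prob_space)
  also have "\<dots> = (A - \<mu>\<^sup>2) / n + (\<mu> - c)\<^sup>2"
    unfolding ES ES2 using n by (simp add: power2_eq_square field_simps)
  finally show ?eq unfolding S_def .
qed

lemma sinc_estimator_eq: "sinc_estimator n h X x = (\<Sum>j=1..n. sinc_kernel h (x - X j)) / n"
proof -
  have "(\<Sum>j=1..n. sinc_kernel h (x - X j))
      = (\<Sum>j=1..n. if x = X j then 1 / h else sin ((x - X j) / h) / (x - X j)) / pi"
    unfolding sum_divide_distrib by (intro sum.cong refl) (simp add: sinc_kernel_def)
  then show ?thesis by (simp add: sinc_estimator_def)
qed

lemma prob_densityD:
  assumes "prob_density f"
  shows "f \<in> borel_measurable borel" "\<And>x. 0 \<le> f x" "integrable lborel f" "(\<integral>x. f x \<partial>lborel) = 1"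
proof -
  show f: "f \<in> borel_measurable borel" "\<And>x. 0 \<le> f x" using assms by (auto simp: prob_density_def)
  have "has_bochner_integral lborel f 1"
    using f assms by (intro has_bochner_integral_nn_integral) (auto simp: prob_density_def)
  then show "integrable lborel f" "(\<integral>x. f x \<partial>lborel) = 1" by (auto simp: has_bochner_integral_iff)
qed

lemma integrable_sinc_kernel_square_mult:
  assumes h: "h > 0" and f: "integrable lborel f"
  shows "integrable lborel (\<lambda>y. f y * (sinc_kernel h (x - y))\<^sup>2)"
proof (rule Bochner_Integration.integrable_bound)
  have [measurable]: "f \<in> borel_measurable borel" using f by auto
  show "integrable lborel (\<lambda>y. f y * (1 / (pi * h))\<^sup>2)" using f by simp
  have "(sinc_kernel h (x - y))\<^sup>2 \<le> (1 / (pi * h))\<^sup>2" for y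
    using power_mono[OF abs_sinc_kernel_le[OF h, of "x - y"], of 2] by simp
  then show "AE y in lborel. norm (f y * (sinc_kernel h (x - y))\<^sup>2) \<le> norm (f y * (1 / (pi * h))\<^sup>2)"
    by (intro AE_I2) (simp add: abs_mult mult_left_mono)
  show "(\<lambda>y. f y * (sinc_kernel h (x - y))\<^sup>2) \<in> borel_measurable lborel" by measurable
qed

text \<open>The second moment of \<open>sinc_kernel h (x - Y)\<close> for \<open>Y\<close> with density \<open>f\<close>; \<open>sinc_smooth h f x\<close> is the first
  moment.\<close>

definition sinc_second_moment :: "real \<Rightarrow> (real \<Rightarrow> real) \<Rightarrow> real \<Rightarrow> real" where
  "sinc_second_moment h f x = (\<integral>y. f y * (sinc_kernel h (x - y))\<^sup>2 \<partial>lborel)"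

lemma nn_integral_sinc_second_moment_le:
  assumes h: "h > 0" and f: "prob_density f"
  shows "(\<integral>\<^sup>+x. ennreal (sinc_second_moment h f x) \<partial>lborel) \<le> ennreal (1 / (pi * h))"
proof -
  note [measurable] = prob_densityD(1)[OF f]
  have "(\<integral>\<^sup>+x. ennreal (sinc_second_moment h f x) \<partial>lborel)
      = (\<integral>\<^sup>+x. \<integral>\<^sup>+y. ennreal (f y) * ennreal ((sinc_kernel h (x - y))\<^sup>2) \<partial>lborel \<partial>lborel)"
    unfolding sinc_second_moment_def using prob_densityD(2)[OF f]
    by (subst nn_integral_eq_integral[symmetric])
       (auto intro: integrable_sinc_kernel_square_mult[OF h prob_densityD(3)[OF f]] simp: ennreal_mult)
  also have "\<dots> = (\<integral>\<^sup>+y. \<integral>\<^sup>+x. ennreal (f y) * ennreal ((sinc_kernel h (x - y))\<^sup>2) \<partial>lborel \<partial>lborel)"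
    by (rule lborel_pair.Fubini') measurable
  also have "\<dots> = (\<integral>\<^sup>+y. ennreal (f y) * (\<integral>\<^sup>+x. ennreal ((sinc_kernel h x)\<^sup>2) \<partial>lborel) \<partial>lborel)"
  proof (intro nn_integral_cong)
    fix y
    have "(\<integral>\<^sup>+x. ennreal ((sinc_kernel h x)\<^sup>2) \<partial>lborel) = (\<integral>\<^sup>+x. ennreal ((sinc_kernel h (x - y))\<^sup>2) \<partial>lborel)"
      using nn_integral_real_affine[of "\<lambda>x. ennreal ((sinc_kernel h x)\<^sup>2)" 1 "- y"] by simp
    then show "(\<integral>\<^sup>+x. ennreal (f y) * ennreal ((sinc_kernel h (x - y))\<^sup>2) \<partial>lborel)
        = ennreal (f y) * (\<integral>\<^sup>+x. ennreal ((sinc_kernel h x)\<^sup>2) \<partial>lborel)"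
      by (simp add: nn_integral_cmult)
  qed
  also have "\<dots> = (\<integral>\<^sup>+x. ennreal ((sinc_kernel h x)\<^sup>2) \<partial>lborel)"
    using f by (simp add: nn_integral_multc prob_density_def)
  also have "\<dots> \<le> ennreal (1 / (pi * h))" by (rule nn_integral_sinc_kernel_square_le[OF h])
  finally show ?thesis .
qed

text \<open>This is what makes the final inequality strict. If \<open>sinc_smooth h f\<close> vanished almost everywhere, its
  pairing with \<open>f\<close>, which is $\frac{1}{2\pi}$ times the integral of \<open>\<bar>fourier f\<bar>\<^sup>2\<close> over the band, would vanish;
  but the characteristic function is continuous with value \<open>1\<close> at \<open>0\<close>.\<close>

lemma nn_integral_sinc_smooth_square_pos:
  assumes h: "h > 0" and f: "prob_density f"
  shows "(\<integral>\<^sup>+x. ennreal ((sinc_smooth h f x)\<^sup>2) \<partial>lborel) > 0"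
proof (rule ccontr)
  note fD = prob_densityD[OF f]
  let ?f = "\<lambda>x. complex_of_real (f x)"
  have f': "integrable lborel ?f" using fD(3) by simp
  note [measurable] = fD(1) borel_measurable_sinc_smooth[OF fD(1), of h] borel_measurable_fourier[OF f']
  assume "\<not> ?thesis"
  then have "AE x in lborel. sinc_smooth h f x = 0"
    by (subst (asm) not_gr_zero, subst (asm) nn_integral_0_iff_AE) auto
  then have "(\<integral>x. sinc_smooth h f x * f x \<partial>lborel) = (\<integral>x. 0 \<partial>(lborel :: real measure))"
    by (intro integral_cong_AE) (auto elim: eventually_mono)
  have square: "cnj z * z = (of_real (cmod z))\<^sup>2" for z
    using complex_norm_square[of z] by (simp add: mult.commute)
  have "(\<lambda>t. band h t * cnj (fourier ?f t) * fourier ?f t)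
      = (\<lambda>t. of_real (indicator {- (1 / h)..1 / h} t * (cmod (fourier ?f t))\<^sup>2))"
    unfolding mult.assoc square by (simp add: of_real_indicator)
  with \<open>(\<integral>x. sinc_smooth h f x * f x \<partial>lborel) = _\<close>
  have "(\<integral>t. indicator {- (1 / h)..1 / h} t * (cmod (fourier ?f t))\<^sup>2 \<partial>lborel) = 0"
    using integral_sinc_smooth_mult[OF h fD(3) fD(3)] by (simp only: integral_complex_of_real) simp
  moreover have "integrable lborel (\<lambda>t. indicator {- (1 / h)..1 / h} t * (cmod (fourier ?f t))\<^sup>2)"
  proof (rule Bochner_Integration.integrable_bound)
    show "integrable lborel (\<lambda>t. indicator {- (1 / h)..1 / h} t * (\<integral>x. cmod (?f x) \<partial>lborel)\<^sup>2)"
      by (intro integrable_mult_left integrable_real_indicator) (simp_all add: emeasure_lborel_Icc_eq)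
    show "AE t in lborel. norm (indicator {- (1 / h)..1 / h} t * (cmod (fourier ?f t))\<^sup>2)
        \<le> norm (indicator {- (1 / h)..1 / h} t * (\<integral>x. cmod (?f x) \<partial>lborel)\<^sup>2)"
      using norm_fourier_le[OF f'] by (intro AE_I2) (auto split: split_indicator intro!: power_mono)
  qed measurable
  ultimately have zero: "AE t in lborel. indicator {- (1 / h)..1 / h} t * (cmod (fourier ?f t))\<^sup>2 = 0"
    by (subst (asm) integral_nonneg_eq_0_iff_AE) auto
  have "fourier ?f 0 = 1" unfolding fourier_def using fD(4) by (simp add: integral_complex_of_real)
  then have "\<forall>\<^sub>F t in at 0. fourier ?f t \<noteq> 0"
    using continuous_fourier[OF f', of 0] unfolding isCont_def
    by (intro tendsto_imp_eventually_ne) auto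
  then obtain d where d: "d > 0" "\<And>t. t \<noteq> 0 \<Longrightarrow> \<bar>t\<bar> < d \<Longrightarrow> fourier ?f t \<noteq> 0"
    unfolding eventually_at by (auto simp: dist_real_def)
  define e where "e = min d (1 / h)"
  have e: "e > 0" using d(1) h by (simp add: e_def)
  from zero have "AE t in lborel. t \<notin> {0<..<e}"
  proof eventually_elim
    case (elim t)
    show ?case
    proof
      assume "t \<in> {0<..<e}"
      then have "fourier ?f t \<noteq> 0" "t \<in> {- (1 / h)..1 / h}" using d(2)[of t] by (auto simp: e_def)
      with elim show False by simp
    qed
  qed
  then have "emeasure lborel {0<..<e} = 0"
    by (subst (asm) AE_iff_measurable[of "{0<..<e}"]) auto
  then show False using e by simp
qed

text \<open>The variance is the second moment, whose integral is at most \<open>1 / (pi * h)\<close>, minus the square of the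
  mean, whose integral is positive.\<close>

lemma nn_integral_sinc_variance_less:
  assumes h: "h > 0" and f: "prob_density f"
    and nonneg: "\<And>x. (sinc_smooth h f x)\<^sup>2 \<le> sinc_second_moment h f x"
  shows "(\<integral>\<^sup>+x. ennreal (sinc_second_moment h f x - (sinc_smooth h f x)\<^sup>2) \<partial>lborel) < ennreal (1 / (pi * h))"
    (is "?V < _")
proof -
  note [measurable] = prob_densityD(1)[OF f] borel_measurable_sinc_smooth[OF prob_densityD(1)[OF f], of h]
  have [measurable]: "sinc_second_moment h f \<in> borel_measurable borel"
    unfolding sinc_second_moment_def[abs_def] by measurable
  let ?K = "\<integral>\<^sup>+x. ennreal ((sinc_smooth h f x)\<^sup>2) \<partial>lborel"
  have "?V + ?K = (\<integral>\<^sup>+x. ennreal (sinc_second_moment h f x) \<partial>lborel)"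
    using nonneg by (subst nn_integral_add[symmetric]) (auto simp: ennreal_plus[symmetric] simp del: ennreal_plus)
  also have "\<dots> \<le> ennreal (1 / (pi * h))" by (rule nn_integral_sinc_second_moment_le[OF h f])
  finally have le: "?V + ?K \<le> ennreal (1 / (pi * h))" .
  then have "?V \<noteq> \<infinity>" by (auto simp: top_unique)
  then have "?V + 0 < ?V + ?K"
    using nn_integral_sinc_smooth_square_pos[OF h f] by (subst ennreal_add_left_cancel_less) auto
  from less_le_trans[OF this le] show ?thesis by (simp only: add_0_right)
qed

text \<open>By Tonelli the error may be computed pointwise in \<open>x\<close>, where the estimator is a sample mean of
  independent copies of \<open>sinc_kernel h (x - Y)\<close>. The second claim, a variance being nonnegative, is read
  off from the same computation.\<close>

lemma MISE_eq:
  assumes h: "h > 0" and n: "n \<ge> 1" and f: "prob_density f" and X: "iid_sample M f n X"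
  shows "MISE M X f n h = (\<integral>\<^sup>+x. ennreal ((sinc_second_moment h f x - (sinc_smooth h f x)\<^sup>2) / n + (sinc_smooth h f x - f x)\<^sup>2) \<partial>lborel)"
    and "(sinc_smooth h f x)\<^sup>2 \<le> sinc_second_moment h f x"
proof -
  interpret prob_space M using X by (simp add: iid_sample_def)
  interpret P: pair_sigma_finite M lborel ..
  note [measurable] = prob_densityD(1)[OF f]
  have indep: "indep_vars (\<lambda>_. borel) X {1..n}"
    and distr: "\<And>j. j \<in> {1..n} \<Longrightarrow> distributed M lborel (X j) (\<lambda>x. ennreal (f x))"
    using X by (auto simp: iid_sample_def)
  have X_meas: "X j \<in> borel_measurable M" if "j \<in> {1..n}" for j
    using distributed_measurable[OF distr[OF that]] by simp
  have stat: "integrable M (\<lambda>\<omega>. (sinc_estimator n h (\<lambda>j. X j \<omega>) x - c)\<^sup>2)"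
      "expectation (\<lambda>\<omega>. (sinc_estimator n h (\<lambda>j. X j \<omega>) x - c)\<^sup>2)
       = (sinc_second_moment h f x - (sinc_smooth h f x)\<^sup>2) / n + (sinc_smooth h f x - c)\<^sup>2" for x c
  proof -
    have i: "indep_vars (\<lambda>_. borel) (\<lambda>j \<omega>. sinc_kernel h (x - X j \<omega>)) {1..n}"
      by (rule indep_vars_compose2[OF indep]) measurable
    have m: "expectation (\<lambda>\<omega>. sinc_kernel h (x - X j \<omega>)) = sinc_smooth h f x" if "j \<in> {1..n}" for j
      unfolding sinc_smooth_def
      using distributed_integral[OF distr[OF that], of "\<lambda>y. sinc_kernel h (x - y)"] prob_densityD(2)[OF f]
      by (simp add: mult.commute)
    have s: "expectation (\<lambda>\<omega>. (sinc_kernel h (x - X j \<omega>))\<^sup>2) = sinc_second_moment h f x" if "j \<in> {1..n}" for j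
      unfolding sinc_second_moment_def
      using distributed_integral[OF distr[OF that], of "\<lambda>y. (sinc_kernel h (x - y))\<^sup>2"] prob_densityD(2)[OF f]
      by simp
    note * = sample_mean_square_error[OF i n abs_sinc_kernel_le[OF h] m s, of c]
    show "integrable M (\<lambda>\<omega>. (sinc_estimator n h (\<lambda>j. X j \<omega>) x - c)\<^sup>2)"
      unfolding sinc_estimator_eq using *(1) by simp
    show "expectation (\<lambda>\<omega>. (sinc_estimator n h (\<lambda>j. X j \<omega>) x - c)\<^sup>2)
       = (sinc_second_moment h f x - (sinc_smooth h f x)\<^sup>2) / n + (sinc_smooth h f x - c)\<^sup>2"
      unfolding sinc_estimator_eq using *(2) by simp
  qed
  have "0 \<le> expectation (\<lambda>\<omega>. (sinc_estimator n h (\<lambda>j. X j \<omega>) x - sinc_smooth h f x)\<^sup>2)" by simp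
  then have "0 \<le> (sinc_second_moment h f x - (sinc_smooth h f x)\<^sup>2) / n" unfolding stat by simp
  then show "(sinc_smooth h f x)\<^sup>2 \<le> sinc_second_moment h f x"
    using n by (simp add: zero_le_divide_iff)
  have [measurable]: "(\<lambda>(\<omega>, x). sinc_estimator n h (\<lambda>j. X j \<omega>) x) \<in> borel_measurable (M \<Otimes>\<^sub>M lborel)"
  proof -
    have "(\<lambda>p. (\<Sum>j=1..n. sinc_kernel h (snd p - X j (fst p))) / n) \<in> borel_measurable (M \<Otimes>\<^sub>M lborel)"
    proof (intro borel_measurable_divide borel_measurable_sum)
      fix j assume "j \<in> {1..n}"
      note [measurable] = X_meas[OF this]
      show "(\<lambda>p. sinc_kernel h (snd p - X j (fst p))) \<in> borel_measurable (M \<Otimes>\<^sub>M lborel)" by measurable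
    qed auto
    then show ?thesis unfolding sinc_estimator_eq by (simp add: case_prod_beta')
  qed
  have "MISE M X f n h = (\<integral>\<^sup>+x. (\<integral>\<^sup>+\<omega>. ennreal ((sinc_estimator n h (\<lambda>j. X j \<omega>) x - f x)\<^sup>2) \<partial>M) \<partial>lborel)"
    unfolding MISE_def by (rule P.Fubini'[symmetric]) measurable
  also have "\<dots> = (\<integral>\<^sup>+x. ennreal ((sinc_second_moment h f x - (sinc_smooth h f x)\<^sup>2) / n + (sinc_smooth h f x - f x)\<^sup>2) \<partial>lborel)"
    using stat by (intro nn_integral_cong) (simp add: nn_integral_eq_integral)
  finally show "MISE M X f n h = \<dots>" .
qed

lemma MISE_less:
  assumes h: "h > 0" and n: "n \<ge> 1" and f: "prob_density f" and X: "iid_sample M f n X"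
    and bias: "(\<integral>\<^sup>+x. ennreal ((sinc_smooth h f x - f x)\<^sup>2) \<partial>lborel) \<le> ennreal b" and b: "b \<ge> 0"
  shows "MISE M X f n h < ennreal (b + 1 / (pi * real n * h))"
proof -
  note [measurable] = prob_densityD(1)[OF f] borel_measurable_sinc_smooth[OF prob_densityD(1)[OF f], of h]
  have [measurable]: "sinc_second_moment h f \<in> borel_measurable borel"
    unfolding sinc_second_moment_def[abs_def] by measurable
  note nonneg = MISE_eq(2)[OF h n f X]
  let ?V = "\<integral>\<^sup>+x. ennreal (sinc_second_moment h f x - (sinc_smooth h f x)\<^sup>2) \<partial>lborel"
  have V: "?V < ennreal (1 / (pi * h))" by (rule nn_integral_sinc_variance_less[OF h f nonneg])
  then obtain v where v: "?V = ennreal v" "v \<ge> 0" by (cases ?V) auto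
  with V have v_less: "v < 1 / (pi * h)" by (simp add: ennreal_less_iff)
  have "MISE M X f n h = (\<integral>\<^sup>+x. ennreal (1 / n) * ennreal (sinc_second_moment h f x - (sinc_smooth h f x)\<^sup>2)
      + ennreal ((sinc_smooth h f x - f x)\<^sup>2) \<partial>lborel)"
    unfolding MISE_eq(1)[OF h n f X] using nonneg
    by (intro nn_integral_cong) (simp add: ennreal_plus[symmetric] ennreal_mult[symmetric] del: ennreal_plus)
  also have "\<dots> = ennreal (1 / n) * ?V + (\<integral>\<^sup>+x. ennreal ((sinc_smooth h f x - f x)\<^sup>2) \<partial>lborel)"
    by (subst nn_integral_add, measurable, subst nn_integral_cmult) auto
  also have "\<dots> \<le> ennreal (1 / n) * ennreal v + ennreal b"
    unfolding v(1) by (intro add_left_mono bias)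
  also have "\<dots> = ennreal (b + v / n)"
    using v(2) b by (simp add: ennreal_plus[symmetric] ennreal_mult[symmetric] add.commute del: ennreal_plus)
  also have "\<dots> < ennreal (b + 1 / (pi * real n * h))"
  proof -
    have "v / n < 1 / (pi * h) / n" using v_less n by (intro divide_strict_right_mono) auto
    then show ?thesis using v(2) b by (subst ennreal_less_iff) (auto simp: mult_ac)
  qed
  finally show ?thesis .
qed

theorem theorem8p1:
  fixes f :: "real \<Rightarrow> real" and m :: nat
  assumes "prob_density f"
    and "times_differentiable m f"
    and "square_integrable ((deriv ^^ m) f)"
  shows "\<exists>\<epsilon> :: real \<Rightarrow> real.
    (\<forall>h>0. \<epsilon> h \<le> 1) \<and>
    (\<epsilon> \<longlongrightarrow> 0) (at_right 0) \<and>
    (\<forall>n\<ge>1. \<forall>h>0. \<forall>(M :: 'a measure) X. iid_sample M f n X \<longrightarrow>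
       MISE M X f n h
         < ennreal (\<epsilon> h * h ^ (2 * m) * R ((deriv ^^ m) f) + 1 / (pi * real n * h)))"
proof -
  note fD = prob_densityD[OF assms(1)]
  let ?f = "\<lambda>x. complex_of_real (f x)"
  have f': "integrable lborel ?f" using fD(3) by simp
  note [measurable] = borel_measurable_fourier[OF f']
  define r where "r = R ((deriv ^^ m) f)"
  have r: "r \<ge> 0" unfolding r_def R_def by simp
  \<comment> \<open>the squared modulus of the transform of the m-th derivative\<close>
  define W where "W t = t ^ (2 * m) * (cmod (fourier ?f t))\<^sup>2" for t
  have W_nonneg: "W t \<ge> 0" for t unfolding W_def by (simp add: power_mult)
  have [measurable]: "W \<in> borel_measurable borel" unfolding W_def by measurable
  have W_le: "(\<integral>\<^sup>+t. ennreal (W t) \<partial>lborel) \<le> ennreal (2 * pi * r)"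
  proof -
    have "(\<integral>\<^sup>+t. ennreal (W t) \<partial>lborel) \<le> ennreal (2 * pi) * (\<integral>\<^sup>+x. ennreal (((deriv ^^ m) f x)\<^sup>2) \<partial>lborel)"
      unfolding W_def using assms(3) by (intro nn_integral_weighted_fourier_le fD(3) assms(2)) (simp add: square_integrable_def)
    also have "(\<integral>\<^sup>+x. ennreal (((deriv ^^ m) f x)\<^sup>2) \<partial>lborel) = ennreal r"
      unfolding r_def R_def using assms(3) by (intro nn_integral_eq_integral) (auto simp: square_integrable_def)
    finally show ?thesis using r by (simp add: ennreal_mult)
  qed
  then have W: "integrable lborel W"
    using W_nonneg by (intro integrableI_bounded) (auto intro: le_less_trans)
  define I where "I h = (\<integral>t. W t * indicator (- {- (1 / h)..1 / h}) t \<partial>lborel)" for h :: real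
  have W_off: "integrable lborel (\<lambda>t. W t * indicator (- {- (1 / h)..1 / h}) t)" for h :: real
    using W by (intro integrable_real_mult_indicator) auto
  have I_nonneg: "I h \<ge> 0" for h
    unfolding I_def using W_nonneg by (intro Bochner_Integration.integral_nonneg) simp
  have I_le: "I h \<le> 2 * pi * r" for h
  proof -
    have "I h \<le> (\<integral>t. W t \<partial>lborel)"
      unfolding I_def using W_nonneg by (intro integral_mono W_off W) (auto split: split_indicator)
    also have "\<dots> \<le> 2 * pi * r"
      using W_le r W W_nonneg by (subst (asm) nn_integral_eq_integral) auto
    finally show ?thesis .
  qed
  \<comment> \<open>the share of the energy of the m-th derivative that lies outside the band\<close>
  define \<epsilon> where "\<epsilon> h = I h / (2 * pi * r)" for h
  \<comment> \<open>if r = 0 then I vanishes too, so the value 0 of the quotient by 0 is the right one\<close>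
  have \<epsilon>_eq: "\<epsilon> h * h ^ (2 * m) * r = h ^ (2 * m) * I h / (2 * pi)" for h
    using I_le[of h] I_nonneg[of h] by (cases "r = 0") (auto simp: \<epsilon>_def)
  have "\<forall>h>0. \<epsilon> h \<le> 1"
    using I_le r by (auto simp: \<epsilon>_def divide_le_eq_1)
  moreover have "(\<epsilon> \<longlongrightarrow> 0) (at_right 0)"
  proof -
    have "((\<lambda>s. \<integral>t. W t * indicator (- {- s..s}) t \<partial>lborel) \<longlongrightarrow> (\<integral>t. 0 \<partial>(lborel :: real measure))) at_top"
    proof (rule integral_dominated_convergence_at_top)
      show "AE t in lborel. ((\<lambda>s. W t * indicator (- {- s..s}) t) \<longlongrightarrow> 0) at_top"
      proof (intro AE_I2 tendsto_eventually)
        fix t :: real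
        show "\<forall>\<^sub>F s in at_top. W t * indicator (- {- s..s}) t = 0"
          using eventually_ge_at_top[of "\<bar>t\<bar>"] by eventually_elim (auto split: split_indicator)
      qed
      show "\<forall>\<^sub>F s in at_top. AE t in lborel. norm (W t * indicator (- {- s..s}) t) \<le> W t"
        using W_nonneg by (intro always_eventually allI AE_I2) (auto split: split_indicator)
    qed (use W in auto)
    then have "(I \<longlongrightarrow> 0) (at_right 0)"
      unfolding filterlim_at_right_to_top I_def by (simp add: inverse_eq_divide)
    then show ?thesis unfolding \<epsilon>_def by (auto intro!: tendsto_divide_zero)
  qed
  moreover have "MISE M X f n h < ennreal (\<epsilon> h * h ^ (2 * m) * r + 1 / (pi * real n * h))"
    if n: "n \<ge> 1" and h: "h > 0" and X: "iid_sample M f n X" for n h and M :: "'a measure" and X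
  proof (rule MISE_less[OF h n assms(1) X])
    show "0 \<le> \<epsilon> h * h ^ (2 * m) * r" unfolding \<epsilon>_eq using h I_nonneg by simp
    have "(\<integral>\<^sup>+x. ennreal ((sinc_smooth h f x - f x)\<^sup>2) \<partial>lborel)
        \<le> ennreal (1 / (2 * pi)) * (\<integral>\<^sup>+t. ennreal ((cmod (fourier ?f t))\<^sup>2) * indicator (- {- (1 / h)..1 / h}) t \<partial>lborel)"
      by (rule sinc_bias_le[OF h fD(3)])
    also have "\<dots> \<le> ennreal (1 / (2 * pi)) * (\<integral>\<^sup>+t. ennreal (h ^ (2 * m) * (W t * indicator (- {- (1 / h)..1 / h}) t)) \<partial>lborel)"
    proof (intro mult_left_mono nn_integral_mono)
      fix t
      show "ennreal ((cmod (fourier ?f t))\<^sup>2) * indicator (- {- (1 / h)..1 / h}) t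
          \<le> ennreal (h ^ (2 * m) * (W t * indicator (- {- (1 / h)..1 / h}) t))"
      proof (cases "t \<in> - {- (1 / h)..1 / h}")
        case True
        then have "1 / h \<le> \<bar>t\<bar>" by auto
        then have "1 \<le> h * \<bar>t\<bar>" using h by (simp add: field_simps)
        \<comment> \<open>outside the band the weight is at least 1, which produces the factor h ^ (2 * m)\<close>
        then have "1 \<le> (h * \<bar>t\<bar>) ^ (2 * m)" by (rule one_le_power)
        then have "1 * (cmod (fourier ?f t))\<^sup>2 \<le> h ^ (2 * m) * t ^ (2 * m) * (cmod (fourier ?f t))\<^sup>2"
          by (intro mult_right_mono) (simp_all add: power_mult_distrib power_even_abs)
        then show ?thesis using True by (auto simp: W_def mult.assoc intro: ennreal_leI)
      qed simp
    qed simp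
    also have "\<dots> = ennreal (1 / (2 * pi)) * ennreal (h ^ (2 * m) * I h)"
      unfolding I_def using h W_nonneg W_off by (subst nn_integral_eq_integral) auto
    also have "\<dots> = ennreal (\<epsilon> h * h ^ (2 * m) * r)"
      unfolding \<epsilon>_eq using h I_nonneg by (simp add: ennreal_mult[symmetric])
    finally show "(\<integral>\<^sup>+x. ennreal ((sinc_smooth h f x - f x)\<^sup>2) \<partial>lborel) \<le> ennreal (\<epsilon> h * h ^ (2 * m) * r)" .
  qed
  ultimately show ?thesis unfolding r_def by blast
qed

end
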